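(* Let $g_1,\dots,g_m\in\operatorname{Sym}\mathcal F_n$ and $h_1,\dots,h_\ell\in\mathcal F_n$, and assume that $\mathcal Q^{\mathbb R}(\mathbf g,\mathbf h)$ is Archimedean. A real-valued quaternionic pseudo-moment sequence $\mathbf y=(y_w)_{w\in\mathcal W}$ has a positive Borel representing measure supported on $K_{\mathbf g,\mathbf h}$ if and only if all of the following conditions hold: $$\begin{aligned}L_{\mathbf y}(p^*p)&\ge0&&(p\in\mathcal F_n),\\ L_{\mathbf y}(p^*g_ip)&\ge0&&(p\in\mathcal F_n,\ i=1,\dots,m),\\ L_{\mathbf y}(uh_jv)&=0&&(u,v\in\mathcal W,\ j=1,\dots,\ell),\\ L_{\mathbf y}(u[w+w^*,q_i]v)&=0&&(u,v,w\in\mathcal W,\ i=1,\dots,n).\end{aligned}$$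
   Context: $\mathbb H$ is the skew field of quaternions, $\mathcal R(a)$ the real part of $a\in\mathbb H$. Fix $n\ge1$ and letters $q_1,\dots,q_n,\bar q_1,\dots,\bar q_n$. $\mathcal W$ is the set of words (including the empty word $1$) in these letters, where words with the same normal form are identified: any consecutive factor $q_i\bar q_i$ or $\bar q_iq_i$ is written $|q_i|^2$ and moved to the front, so each word is uniquely $\prod_i|q_i|^{2\alpha_i}\tilde w$ with $\tilde w$ containing no such factor. $w^*$ is obtained by reversing $w$ and exchanging $q_i\leftrightarrow\bar q_i$. $\mathcal F_n=\mathbb R\langle\mathbf q,\bar{\mathbf q}\rangle$ is the real $*$-algebra of finite sums $\sum_wp_ww$, $p_w\in\mathbb R$, with $p^*=\sum_wp_ww^*$; $\operatorname{Sym}$ denotes elements with $p=p^*$; $[a,b]$ is the commutator. $p(\mathbf a,\bar{\mathbf a})$ is the evaluation $q_i\mapsto a_i,\bar q_i\mapsto\bar a_i$ at $\mathbf a\in\mathbb H^n$. Words $u,v$ are cyclically equivalent, $u\stackrel{\mathrm{cyc}}{\sim}v$, if $u=w_1w_2$, $v=w_2w_1$ for some words $w_1,w_2$. A real-valued sequence $\mathbf y=(y_w)_{w\in\mathcal W}$ is a quaternionic pseudo-moment sequence if $y_w=y_{w^*}$ for all $w$ and $y_u=y_v$ whenever $u\stackrel{\mathrm{cyc}}{\sim}v$. It defines $L_{\mathbf y}:\mathcal F_n\to\mathbb R$, $L_{\mathbf y}(\sum_wp_ww)=\sum_wp_wy_w$. A positive Borel measure $\mu$ on $\mathbb H^n$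 represents $\mathbf y$ if $y_w=\int\mathcal R(w(\mathbf a,\bar{\mathbf a}))\,d\mu(\mathbf a)$ for all $w\in\mathcal W$ (all integrals being finite). $K_{\mathbf g,\mathbf h}=\{\mathbf a\in\mathbb H^n: g_i(\mathbf a,\bar{\mathbf a})\ge0\ (1\le i\le m),\ h_j(\mathbf a,\bar{\mathbf a})=0\ (1\le j\le\ell)\}$. $\Sigma^{\mathbb R}$ is the set of finite sums $\sum_sp_s^*p_s$, $p_s\in\mathcal F_n$. $\mathcal Q^{\mathbb R}(\mathbf g,\mathbf h)$ is the set of all finite expressions $\sigma_0+\tfrac12\sum_i(\sigma_ig_i+g_i\sigma_i)+\sum_j\sum_\alpha(\tau_{j\alpha}h_j\nu_{j\alpha}+\nu_{j\alpha}^*h_j^*\tau_{j\alpha}^* )$ with $\sigma_i\in\Sigma^{\mathbb R}$, $\tau_{j\alpha},\nu_{j\alpha}\in\mathcal F_n$; it is Archimedean if $R-\sum_{i=1}^n|q_i|^2\in\mathcal Q^{\mathbb R}(\mathbf g,\mathbf h)$ for some $R>0$. *)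

theory Defs
  imports "HOL-Analysis.Analysis" "HOL-Library.Poly_Mapping"
begin

section \<open>The quaternions\<close>

codatatype quat = Quat (qRe: real) (qIm1: real) (qIm2: real) (qIm3: real)

lemma quat_eq_iff:
  "x = y \<longleftrightarrow> qRe x = qRe y \<and> qIm1 x = qIm1 y \<and> qIm2 x = qIm2 y \<and> qIm3 x = qIm3 y"
  by (auto intro: quat.expand)

instantiation quat :: ab_group_add
begin

primcorec zero_quat where
  "qRe 0 = 0" | "qIm1 0 = 0" | "qIm2 0 = 0" | "qIm3 0 = 0"

primcorec plus_quat where
  "qRe (x + y) = qRe x + qRe y"
| "qIm1 (x + y) = qIm1 x + qIm1 y"
| "qIm2 (x + y) = qIm2 x + qIm2 y"
| "qIm3 (x + y) = qIm3 x + qIm3 y"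

primcorec uminus_quat where
  "qRe (- x) = - qRe x"
| "qIm1 (- x) = - qIm1 x"
| "qIm2 (- x) = - qIm2 x"
| "qIm3 (- x) = - qIm3 x"

primcorec minus_quat where
  "qRe (x - y) = qRe x - qRe y"
| "qIm1 (x - y) = qIm1 x - qIm1 y"
| "qIm2 (x - y) = qIm2 x - qIm2 y"
| "qIm3 (x - y) = qIm3 x - qIm3 y"

instance
  by standard (simp_all add: quat_eq_iff)

end

instantiation quat :: real_algebra_1
begin

primcorec one_quat where
  "qRe 1 = 1" | "qIm1 1 = 0" | "qIm2 1 = 0" | "qIm3 1 = 0"

primcorec times_quat where
  "qRe (x * y) = qRe x * qRe y - qIm1 x * qIm1 y - qIm2 x * qIm2 y - qIm3 x * qIm3 y"
| "qIm1 (x * y) = qRe x * qIm1 y + qIm1 x * qRe y + qIm2 x * qIm3 y - qIm3 x * qIm2 y"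
| "qIm2 (x * y) = qRe x * qIm2 y - qIm1 x * qIm3 y + qIm2 x * qRe y + qIm3 x * qIm1 y"
| "qIm3 (x * y) = qRe x * qIm3 y + qIm1 x * qIm2 y - qIm2 x * qIm1 y + qIm3 x * qRe y"

primcorec scaleR_quat where
  "qRe (scaleR r x) = r * qRe x"
| "qIm1 (scaleR r x) = r * qIm1 x"
| "qIm2 (scaleR r x) = r * qIm2 x"
| "qIm3 (scaleR r x) = r * qIm3 x"

instance
  by standard (simp_all add: quat_eq_iff algebra_simps)

end

primcorec qcnj :: "quat \<Rightarrow> quat" where
  "qRe (qcnj x) = qRe x"
| "qIm1 (qcnj x) = - qIm1 x"
| "qIm2 (qcnj x) = - qIm2 x"
| "qIm3 (qcnj x) = - qIm3 x"

instantiation quat :: real_inner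
begin

definition "inner x y = qRe x * qRe y + qIm1 x * qIm1 y + qIm2 x * qIm2 y + qIm3 x * qIm3 y"
  for x y :: quat

definition "norm x = sqrt (inner x x)" for x :: quat

definition "sgn x = x /\<^sub>R norm x" for x :: quat

definition "dist x y = norm (x - y)" for x y :: quat

definition uniformity_quat_def [code del]:
  "(uniformity :: (quat \<times> quat) filter) = (INF e\<in>{0 <..}. principal {(x, y). dist x y < e})"

definition open_quat_def [code del]:
  "open (U :: quat set) \<longleftrightarrow> (\<forall>x\<in>U. eventually (\<lambda>(x', y). x' = x \<longrightarrow> y \<in> U) uniformity)"

instance
proof
  fix x y z :: quat and r :: real
  show "inner x y = inner y x"
    by (simp add: inner_quat_def mult.commute)
  show "inner (x + y) z = inner x z + inner y z"
    by (simp add: inner_quat_def distrib_right)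
  show "inner (scaleR r x) y = r * inner x y"
    by (simp add: inner_quat_def distrib_left mult.assoc)
  show "0 \<le> inner x x"
    by (simp add: inner_quat_def)
  show "inner x x = 0 \<longleftrightarrow> x = 0"
    by (simp add: inner_quat_def quat_eq_iff add_nonneg_eq_0_iff)
qed (rule norm_quat_def sgn_quat_def dist_quat_def uniformity_quat_def open_quat_def)+

end

instantiation quat :: euclidean_space
begin

definition "Basis = {Quat 1 0 0 0, Quat 0 1 0 0, Quat 0 0 1 0, Quat 0 0 0 1}"

instance
proof
  fix x u v :: quat
  show "(\<forall>u\<in>Basis. inner x u = 0) \<longleftrightarrow> x = 0"
    unfolding Basis_quat_def quat_eq_iff[of x] by (simp add: inner_quat_def)
  assume "u \<in> Basis" "v \<in> Basis"
  then show "inner u v = (if u = v then 1 else 0)"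
    unfolding Basis_quat_def by (elim insertE emptyE) (simp_all add: inner_quat_def quat_eq_iff)
qed (simp_all add: Basis_quat_def)

end

instantiation quat :: real_normed_div_algebra
begin

definition "inverse x = qcnj x /\<^sub>R (norm x)\<^sup>2" for x :: quat

definition "x div y = x * inverse y" for x y :: quat

instance
proof
  fix x y :: quat
  have sq: "(norm z)\<^sup>2 = (qRe z)\<^sup>2 + (qIm1 z)\<^sup>2 + (qIm2 z)\<^sup>2 + (qIm3 z)\<^sup>2" for z :: quat
    unfolding power2_norm_eq_inner by (simp add: inner_quat_def power2_eq_square)
  have cr: "qcnj z * z = scaleR ((norm z)\<^sup>2) 1" and cl: "z * qcnj z = scaleR ((norm z)\<^sup>2) 1"
    for z :: quat
    by (simp_all only: quat_eq_iff sq) (simp_all add: power2_eq_square)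
  show "inverse x * x = 1" "x * inverse x = 1" if "x \<noteq> 0"
    using that by (simp_all add: inverse_quat_def cr cl)
  show "x div y = x * inverse y"
    by (simp add: divide_quat_def)
  show "inverse (0::quat) = 0"
    by (simp add: inverse_quat_def)
  have "(norm (x * y))\<^sup>2 = (norm x * norm y)\<^sup>2"
    unfolding power_mult_distrib sq by (simp add: power2_eq_square algebra_simps)
  then show "norm (x * y) = norm x * norm y"
    by simp
qed

end


section \<open>Words\<close>

datatype 'n letter = Q 'n | Qbar 'n

fun bar :: "'n letter \<Rightarrow> 'n letter" where
  "bar (Q i) = Qbar i"
| "bar (Qbar i) = Q i"

fun idx :: "'n letter \<Rightarrow> 'n" where
  "idx (Q i) = i"
| "idx (Qbar i) = i"

text \<open>The pair \<open>(\<alpha>, w)\<close> stands for \<open>\<Prod>\<^sub>i |q\<^sub>i|\<^sup>2\<^sup>\<alpha>\<^sup>i w\<close>. The normal form is computed by adjoining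
  the letters one by one from the right; a letter meeting its conjugate is cancelled and counted
  in \<open>\<alpha>\<close>.\<close>

fun push :: "'n letter \<Rightarrow> ('n \<Rightarrow> nat) \<times> 'n letter list \<Rightarrow> ('n \<Rightarrow> nat) \<times> 'n letter list" where
  "push x (\<alpha>, []) = (\<alpha>, [x])"
| "push x (\<alpha>, y # w) =
     (if y = bar x then (\<alpha>(idx x := Suc (\<alpha> (idx x))), w) else (\<alpha>, x # y # w))"

definition normal_form :: "'n letter list \<Rightarrow> ('n \<Rightarrow> nat) \<times> 'n letter list" where
  "normal_form u = foldr push u (\<lambda>_. 0, [])"

definition list_star :: "'n letter list \<Rightarrow> 'n letter list" where
  "list_star u = rev (map bar u)"

fun letter_eval :: "quat ^ 'n \<Rightarrow> 'n letter \<Rightarrow> quat" where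
  "letter_eval a (Q i) = a $ i"
| "letter_eval a (Qbar i) = qcnj (a $ i)"

definition list_eval :: "quat ^ 'n \<Rightarrow> 'n letter list \<Rightarrow> quat" where
  "list_eval a u = prod_list (map (letter_eval a) u)"

subsection \<open>Compatibility of the operations with normal forms\<close>

lemma bar_bar [simp]: "bar (bar x) = x"
  by (cases x) auto

lemma idx_bar [simp]: "idx (bar x) = idx x"
  by (cases x) auto

lemma bar_neq [simp]: "bar x \<noteq> x" "x \<noteq> bar x"
  by (cases x; auto)+

definition shift :: "('n \<Rightarrow> nat) \<Rightarrow> ('n \<Rightarrow> nat) \<times> 'n letter list \<Rightarrow> ('n \<Rightarrow> nat) \<times> 'n letter list" where
  "shift \<beta> s = (\<lambda>i. \<beta> i + fst s i, snd s)"

definition unit_exp :: "'n \<Rightarrow> 'n \<Rightarrow> nat" where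
  "unit_exp j = (\<lambda>i. if i = j then 1 else 0)"

fun reduced :: "'n letter list \<Rightarrow> bool" where
  "reduced (x # y # w) \<longleftrightarrow> y \<noteq> bar x \<and> reduced (y # w)"
| "reduced _ \<longleftrightarrow> True"

lemma shift_0 [simp]: "shift (\<lambda>_. 0) s = s"
  by (simp add: shift_def)

lemma shift_shift: "shift \<beta> (shift \<gamma> s) = shift (\<lambda>i. \<beta> i + \<gamma> i) s"
  by (simp add: shift_def add.assoc)

lemma push_shift: "push x (shift \<beta> s) = shift \<beta> (push x s)"
  by (cases "(x, s)" rule: push.cases) (auto simp: shift_def)

lemma foldr_push_shift: "foldr push u (shift \<beta> s) = shift \<beta> (foldr push u s)"
  by (induction u) (auto simp: push_shift)

lemma push_Cons_bar: "push x (\<alpha>, bar x # w) = shift (unit_exp (idx x)) (\<alpha>, w)"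
  by (auto simp: shift_def unit_exp_def fun_eq_iff)

lemma reduced_tl: "reduced (x # w) \<Longrightarrow> reduced w"
  by (cases w) auto

lemma reduced_push: "reduced (snd s) \<Longrightarrow> reduced (snd (push x s))"
  by (cases "(x, s)" rule: push.cases) (auto dest: reduced_tl)

lemma reduced_foldr_push: "reduced (snd s) \<Longrightarrow> reduced (snd (foldr push u s))"
  by (induction u) (auto intro: reduced_push)

lemma reduced_normal_form: "reduced (snd (normal_form u))"
  by (simp add: normal_form_def reduced_foldr_push)

lemma push_push_bar:
  assumes "reduced (snd s)"
  shows "push x (push (bar x) s) = shift (unit_exp (idx x)) s"
proof -
  obtain \<alpha> w where s: "s = (\<alpha>, w)"
    by (cases s)
  show ?thesis
  proof (cases w)
    case Nil
    then show ?thesis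
      by (simp add: s shift_def unit_exp_def fun_eq_iff)
  next
    case (Cons y v)
    show ?thesis
    proof (cases "y = x")
      case True
      have "push (bar x) s = shift (unit_exp (idx x)) (\<alpha>, v)"
        using push_Cons_bar[of "bar x" \<alpha> v] by (simp add: s Cons True)
      moreover have "push x (\<alpha>, v) = (\<alpha>, x # v)"
        using assms by (cases v) (auto simp: s Cons True)
      ultimately show ?thesis
        by (simp add: push_shift s Cons True)
    next
      case False
      then have "push (bar x) s = (\<alpha>, bar x # y # v)"
        by (simp add: s Cons)
      then show ?thesis
        by (simp only: push_Cons_bar s Cons)
    qed
  qed
qed

lemma push_cases:
  obtains (cancel) w where "snd s = bar x # w" "push x s = shift (unit_exp (idx x)) (fst s, w)"
  | (keep) "push x s = (fst s, x # snd s)"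
proof (cases "\<exists>w. snd s = bar x # w")
  case True
  then obtain w where w: "snd s = bar x # w"
    by blast
  then have "s = (fst s, bar x # w)"
    by (simp add: prod_eq_iff)
  then have "push x s = shift (unit_exp (idx x)) (fst s, w)"
    using push_Cons_bar by metis
  with w show ?thesis
    by (rule cancel)
next
  case False
  have "push x s = (fst s, x # snd s)"
    using False by (cases "(x, s)" rule: push.cases) auto
  then show ?thesis
    by (rule keep)
qed

lemma normal_form_Cons: "normal_form (x # u) = push x (normal_form u)"
  by (simp add: normal_form_def)

lemma foldr_push_normal_form:
  assumes "reduced (snd s)"
  shows "foldr push u s = shift (fst (normal_form u)) (foldr push (snd (normal_form u)) s)"
proof (induction u)
  case Nil
  then show ?case
    by (simp add: normal_form_def)
next
  case (Cons x u)
  show ?case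
  proof (cases rule: push_cases[of "normal_form u" x])
    case (cancel w)
    have "foldr push (x # u) s
        = shift (fst (normal_form u)) (push x (push (bar x) (foldr push w s)))"
      by (simp add: Cons cancel(1) push_shift)
    also have "\<dots> = shift (fst (normal_form u)) (shift (unit_exp (idx x)) (foldr push w s))"
      by (simp add: push_push_bar reduced_foldr_push assms)
    finally show ?thesis
      by (simp add: normal_form_Cons cancel(2) shift_shift) (simp add: shift_def add.commute)
  next
    case keep
    then show ?thesis
      by (simp add: normal_form_Cons Cons push_shift)
  qed
qed

lemma normal_form_append:
  "normal_form (u @ v) = shift (fst (normal_form u)) (foldr push (snd (normal_form u)) (normal_form v))"
  using foldr_push_normal_form[OF reduced_normal_form, of u v]
  by (simp add: normal_form_def)

lemma normal_form_list_star:
  "normal_form (list_star u) = shift (fst (normal_form u)) (normal_form (list_star (snd (normal_form u))))"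
proof (induction u)
  case Nil
  then show ?case
    by (simp add: normal_form_def list_star_def)
next
  case (Cons x u)
  have star_Cons: "list_star (z # v) = list_star v @ [bar z]" for z :: "'a letter" and v
    by (simp add: list_star_def)
  define r where "r = list_star (snd (normal_form u))"
  define \<beta> where "\<beta> = fst (normal_form u)"
  have IH: "normal_form (list_star u) = shift \<beta> (normal_form r)"
    using Cons by (simp add: r_def \<beta>_def)
  have "normal_form (list_star (x # u)) = shift \<beta> (normal_form (r @ [bar x]))"
    unfolding star_Cons normal_form_append IH by (simp add: shift_def add.assoc)
  also have "\<dots> = shift (fst (normal_form (x # u)))
      (normal_form (list_star (snd (normal_form (x # u)))))"
  proof (cases rule: push_cases[of "normal_form u" x])
    case (cancel w)
    have xx: "normal_form [x, bar x] = shift (unit_exp (idx x)) (normal_form [])"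
      using push_push_bar[of "(\<lambda>_. 0, [])" x] by (simp add: normal_form_def)
    have "r @ [bar x] = list_star w @ [x, bar x]"
      by (simp add: r_def cancel(1) star_Cons)
    also have "normal_form \<dots> = shift (unit_exp (idx x)) (normal_form (list_star w))"
    proof -
      let ?v = "list_star w"
      have "normal_form (?v @ [x, bar x]) = shift (unit_exp (idx x))
          (shift (fst (normal_form ?v)) (foldr push (snd (normal_form ?v)) (normal_form [])))"
        unfolding normal_form_append xx foldr_push_shift by (simp add: shift_def add.left_commute)
      then show ?thesis
        unfolding normal_form_append[symmetric] by simp
    qed
    finally show ?thesis
      by (simp add: normal_form_Cons cancel(2) shift_shift \<beta>_def)
        (simp add: shift_def add.commute)
  next
    case keep
    then show ?thesis
      by (simp add: normal_form_Cons star_Cons r_def \<beta>_def)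
  qed
  finally show ?case .
qed

lemma letter_eval_bar: "letter_eval a x * letter_eval a (bar x) = of_real ((norm (a $ idx x))\<^sup>2)"
proof -
  have "(norm z)\<^sup>2 = qRe z * qRe z + qIm1 z * qIm1 z + qIm2 z * qIm2 z + qIm3 z * qIm3 z" for z :: quat
    unfolding power2_norm_eq_inner by (simp add: inner_quat_def)
  then show ?thesis
    by (cases x) (simp_all add: of_real_def quat_eq_iff)
qed

lemma list_eval_normal_form:
  fixes a :: "quat ^ 'n::finite"
  shows "list_eval a u = of_real (\<Prod>i\<in>UNIV. (norm (a $ i)) ^ (2 * fst (normal_form u) i))
    * list_eval a (snd (normal_form u))"
proof (induction u)
  case Nil
  then show ?case
    by (simp add: normal_form_def)
next
  case (Cons x u)
  define c where "c \<beta> = (\<Prod>i\<in>UNIV. (norm (a $ i)) ^ (2 * \<beta> i))" for \<beta> :: "'n \<Rightarrow> nat"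
  have c_add: "c (\<lambda>i. \<beta> i + \<gamma> i) = c \<beta> * c \<gamma>" for \<beta> \<gamma>
    by (simp add: c_def distrib_left power_add prod.distrib)
  have c_unit: "c (unit_exp j) = (norm (a $ j))\<^sup>2" for j
  proof -
    have "c (unit_exp j) = (\<Prod>i\<in>UNIV. if i = j then (norm (a $ i))\<^sup>2 else 1)"
      unfolding c_def unit_exp_def by (rule prod.cong) auto
    then show ?thesis
      by simp
  qed
  have IH: "list_eval a u = of_real (c (fst (normal_form u))) * list_eval a (snd (normal_form u))"
    using Cons by (simp add: c_def)
  have "list_eval a (x # u) = letter_eval a x * list_eval a u"
    by (simp add: list_eval_def)
  also have "\<dots> = of_real (c (fst (normal_form u)))
      * (letter_eval a x * list_eval a (snd (normal_form u)))"
    unfolding IH of_real_def by simp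
  also have "\<dots> = of_real (c (fst (normal_form (x # u)))) * list_eval a (snd (normal_form (x # u)))"
  proof (cases rule: push_cases[of "normal_form u" x])
    case (cancel w)
    have "letter_eval a x * list_eval a (snd (normal_form u))
        = of_real (c (unit_exp (idx x))) * list_eval a w"
    proof -
      have "letter_eval a x * list_eval a (bar x # w)
          = (letter_eval a x * letter_eval a (bar x)) * list_eval a w"
        by (simp add: list_eval_def mult.assoc)
      then show ?thesis
        by (simp only: cancel(1) letter_eval_bar c_unit)
    qed
    moreover have "c (fst (normal_form (x # u))) = c (fst (normal_form u)) * c (unit_exp (idx x))"
      by (simp add: normal_form_Cons cancel(2) shift_def c_add)
    moreover have "snd (normal_form (x # u)) = w"
      by (simp add: normal_form_Cons cancel(2) shift_def)
    ultimately show ?thesis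
      by (simp only: of_real_mult mult.assoc)
  next
    case keep
    then show ?thesis
      by (simp add: normal_form_Cons list_eval_def)
  qed
  finally show ?case
    by (simp add: c_def)
qed

subsection \<open>The monoid of words\<close>

quotient_type 'n qword = "'n letter list" / "\<lambda>u v. normal_form u = normal_form v"
  by (rule equivpI) (auto intro: reflpI sympI transpI)

text \<open>Words with the same normal form are identified. Concatenation is written
  additively and the empty word is \<open>0\<close>, so that the ring structure of the type of finitely
  supported functions \<open>'n qword \<Rightarrow>\<^sub>0 real\<close> is the monoid algebra.\<close>

instantiation qword :: (type) monoid_add
begin

lift_definition zero_qword :: "'a qword" is "[]" .

lift_definition plus_qword :: "'a qword \<Rightarrow> 'a qword \<Rightarrow> 'a qword" is append
  by (simp add: normal_form_append)

instance
  by standard (transfer; simp)+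

end

lift_definition letter_word :: "'n letter \<Rightarrow> 'n qword" is "\<lambda>x. [x]" .

lemma letter_word_bar_central:
  "letter_word x + letter_word (bar x) + w = w + (letter_word x + letter_word (bar x))"
proof transfer
  fix x :: "'a letter" and w
  have "normal_form [x, bar x] = shift (unit_exp (idx x)) (normal_form [])"
    using push_push_bar[of "(\<lambda>_. 0, [])" x] by (simp add: normal_form_def)
  then have "normal_form (w @ [x, bar x]) = shift (unit_exp (idx x))
      (shift (fst (normal_form w)) (foldr push (snd (normal_form w)) (normal_form [])))"
    unfolding normal_form_append by (simp add: foldr_push_shift) (simp add: shift_def add.left_commute)
  then have "normal_form (w @ [x, bar x]) = shift (unit_exp (idx x)) (normal_form w)"
    unfolding normal_form_append[symmetric] by simp
  moreover have "normal_form ([x, bar x] @ w) = shift (unit_exp (idx x)) (normal_form w)"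
    using push_push_bar[OF reduced_normal_form, of x w] by (simp add: normal_form_Cons)
  ultimately show "normal_form (([x] @ [bar x]) @ w) = normal_form (w @ [x] @ [bar x])"
    by simp
qed

lift_definition word_star :: "'n qword \<Rightarrow> 'n qword" is list_star
  by (subst (1 2) normal_form_list_star) simp

lift_definition word_eval :: "quat ^ 'n \<Rightarrow> 'n::finite qword \<Rightarrow> quat" is list_eval
  by (subst (1 2) list_eval_normal_form) simp

definition cyc_equiv :: "'n qword \<Rightarrow> 'n qword \<Rightarrow> bool" where
  "cyc_equiv u v \<longleftrightarrow> (\<exists>w1 w2. u = w1 + w2 \<and> v = w2 + w1)"


section \<open>The free algebra with involution\<close>

type_synonym 'n falg = "'n qword \<Rightarrow>\<^sub>0 real"

abbreviation mon :: "'n qword \<Rightarrow> 'n falg" where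
  "mon w \<equiv> Poly_Mapping.single w 1"

abbreviation const :: "real \<Rightarrow> 'n falg" where
  "const r \<equiv> Poly_Mapping.single 0 r"

definition falg_star :: "'n falg \<Rightarrow> 'n falg" where
  "falg_star p = (\<Sum>w\<in>Poly_Mapping.keys p. Poly_Mapping.single (word_star w) (Poly_Mapping.lookup p w))"

definition falg_eval :: "'n::finite falg \<Rightarrow> quat ^ 'n \<Rightarrow> quat" where
  "falg_eval p a = (\<Sum>w\<in>Poly_Mapping.keys p. Poly_Mapping.lookup p w *\<^sub>R word_eval a w)"

definition Sym :: "'n falg set" where
  "Sym = {p. falg_star p = p}"

definition commutator :: "'n falg \<Rightarrow> 'n falg \<Rightarrow> 'n falg" where
  "commutator p r = p * r - r * p"

definition SOS :: "'n falg set" where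
  "SOS = {(\<Sum>s<N. falg_star (p s) * p s) | (N::nat) (p :: nat \<Rightarrow> 'n falg). True}"

definition quad_module :: "nat \<Rightarrow> (nat \<Rightarrow> 'n falg) \<Rightarrow> nat \<Rightarrow> (nat \<Rightarrow> 'n falg) \<Rightarrow> 'n falg set" where
  "quad_module m g l h =
    {\<sigma> 0 + const (1/2) * (\<Sum>i=1..m. \<sigma> i * g i + g i * \<sigma> i)
      + (\<Sum>j=1..l. \<Sum>\<alpha><N j. \<tau> j \<alpha> * h j * \<nu> j \<alpha>
          + falg_star (\<nu> j \<alpha>) * falg_star (h j) * falg_star (\<tau> j \<alpha>))
     | (\<sigma> :: nat \<Rightarrow> 'n falg) (N :: nat \<Rightarrow> nat)
       (\<tau> :: nat \<Rightarrow> nat \<Rightarrow> 'n falg) (\<nu> :: nat \<Rightarrow> nat \<Rightarrow> 'n falg).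
       \<forall>i\<le>m. \<sigma> i \<in> SOS}"

definition archimedean_module :: "'n::finite falg set \<Rightarrow> bool" where
  "archimedean_module M \<longleftrightarrow>
    (\<exists>R>0. const R - (\<Sum>i\<in>UNIV. mon (letter_word (Q i) + letter_word (Qbar i))) \<in> M)"

text \<open>The value of a symmetric element is a real quaternion; being \<open>\<ge> 0\<close> is membership in
  \<open>\<real>\<^sub>\<ge>\<^sub>0\<close>, viewed as a subset of the quaternions.\<close>

definition semialg_set ::
  "nat \<Rightarrow> (nat \<Rightarrow> 'n::finite falg) \<Rightarrow> nat \<Rightarrow> (nat \<Rightarrow> 'n falg) \<Rightarrow> (quat ^ 'n) set" where
  "semialg_set m g l h =
    {a. (\<forall>i\<in>{1..m}. falg_eval (g i) a \<in> \<real>\<^sub>\<ge>\<^sub>0) \<and> (\<forall>j\<in>{1..l}. falg_eval (h j) a = 0)}"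


section \<open>Pseudo-moment sequences\<close>

definition pseudo_moment_seq :: "('n qword \<Rightarrow> real) \<Rightarrow> bool" where
  "pseudo_moment_seq y \<longleftrightarrow>
    (\<forall>w. y w = y (word_star w)) \<and> (\<forall>u v. cyc_equiv u v \<longrightarrow> y u = y v)"

definition riesz :: "('n qword \<Rightarrow> real) \<Rightarrow> 'n falg \<Rightarrow> real" where
  "riesz y p = (\<Sum>w\<in>Poly_Mapping.keys p. Poly_Mapping.lookup p w * y w)"

definition represents :: "(quat ^ 'n) measure \<Rightarrow> ('n::finite qword \<Rightarrow> real) \<Rightarrow> bool" where
  "represents \<mu> y \<longleftrightarrow> sets \<mu> = sets borel \<and>
    (\<forall>w. integrable \<mu> (\<lambda>a. qRe (word_eval a w)) \<and> y w = (\<integral>a. qRe (word_eval a w) \<partial>\<mu>))"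

end

theory Submission
  imports Defs "HOL-Probability.Probability"
begin

text \<open>
  A functional \<open>L\<close> satisfying the four conditions is a tracial positive functional for which all
  symmetric elements are central. The Archimedean condition bounds \<open>L\<close> on words, so the normalized
  functionals of this kind form a compact convex set. At an extreme point \<open>L\<close> is multiplicative on
  symmetric elements: a square \<open>c\<^sup>2\<close> splits \<open>L\<close> into the two functionals with weights \<open>c\<^sup>2\<close> and
  \<open>C - c\<^sup>2\<close>. The quotient of the free algebra by the null ideal of such an \<open>L\<close> is then \<open>\<real>\<close>, \<open>\<complex>\<close> or
  the quaternions (Frobenius), so \<open>L\<close> is the real part of the evaluation at a point of the
  semialgebraic set. Hence every real combination of moments is bounded below by its value at such a
  point, the moments are limits of moments of finite averages of point masses, and a weak limit of
  these averages is a representing measure.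
\<close>

section \<open>The free algebra\<close>

text \<open>Splitting a functional by a square works only if both parts again satisfy every
  positivity condition. For the second part this demands one constant \<open>C\<close> with L(p* g
  c^2 p) <= C L(p* g p) for every constraint \<open>g\<close>, whereas the Archimedean condition
  directly bounds multiplication by \<open>c\<close> only for \<open>g = 1\<close>. Centrality
  closes this gap: \<open>c\<close> passes \<open>g\<close> under the functional, and log-convexity
  transfers the unweighted growth rate to the weighted form. The Archimedean element itself is
  adjoined to the constraints, so that both parts inherit it like any other \<open>g\<close>.

  At an extreme point p* + p and p* p act as scalars, so the identity p^2 - (p* + p) p + p* p = 0
  becomes a real quadratic equation for every element modulo the null ideal, with the definite norm
  form L(p* p). This is the setting of Frobenius' argument.\<close>

lemma poly_mapping_add_single_induct [case_names zero add]:
  fixes p :: "'a \<Rightarrow>\<^sub>0 'b::comm_monoid_add"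
  assumes "P 0" "\<And>p w r. P p \<Longrightarrow> P (p + Poly_Mapping.single w r)"
  shows "P p"
proof (induction p rule: update_induct)
  case const
  then show ?case by (rule assms)
next
  case (update f a b)
  have "Poly_Mapping.update a b f = f + Poly_Mapping.single a b"
    using update(1) by (intro poly_mapping_eqI)
      (auto simp: lookup_add Poly_Mapping.lookup_update lookup_single when_def in_keys_iff)
  with assms(2)[OF update(3)] show ?case by simp
qed

lemma word_star_0 [simp]: "word_star 0 = 0"
  by transfer (simp add: list_star_def)

lemma word_star_add: "word_star (u + v) = word_star v + word_star u"
  by transfer (simp add: list_star_def)

lemma word_star_word_star [simp]: "word_star (word_star w) = w"
  by transfer (simp add: list_star_def rev_map o_def)

lemma word_star_letter [simp]: "word_star (letter_word x) = letter_word (bar x)"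
  by transfer (simp add: list_star_def)

lemma letter_word_bar_commute:
  "letter_word (bar x) + letter_word x = letter_word x + letter_word (bar x)"
proof transfer
  fix x :: "'a letter"
  have "normal_form [x, bar x] = Defs.shift (unit_exp (idx x)) (normal_form [])" for x :: "'a letter"
    using push_push_bar[of "(\<lambda>_. 0, [])" x] by (simp add: normal_form_def)
  from this[of x] this[of "bar x"]
  show "normal_form ([bar x] @ [x]) = normal_form ([x] @ [bar x])" by simp
qed

text \<open>The letter lists representing a word need not be reduced, so no case of cancellation
  arises.\<close>

lemma qword_induct [case_names zero add, induct type: qword]:
  assumes "P 0" "\<And>x w. P w \<Longrightarrow> P (letter_word x + w)"
  shows "P w"
proof (induct w rule: qword.abs_induct)
  case (1 u)
  show ?case
  proof (induction u)
    case Nil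
    then show ?case using assms(1) by (simp add: zero_qword.abs_eq)
  next
    case (Cons x u)
    then show ?case using assms(2)[of "abs_qword u" x]
      by (simp add: letter_word.abs_eq plus_qword.abs_eq)
  qed
qed

text \<open>This lets all coordinates be minimized, and all moments be approximated, along a single
  sequence.\<close>

lemma countable_qword: "countable (UNIV :: 'n::finite qword set)"
proof -
  have "(UNIV :: 'n letter set) = range Q \<union> range Qbar"
    by (metis UNIV_eq_I UnCI letter.exhaust rangeI)
  then have "countable (UNIV :: 'n letter set)"
    by (metis countable_Un countable_finite finite finite_imageI)
  then have "countable (range (abs_qword :: 'n letter list \<Rightarrow> _))"
    using countable_lists[of "UNIV :: 'n letter set"] by (intro countable_image) simp
  moreover have "range (abs_qword :: 'n letter list \<Rightarrow> _) = UNIV"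
    by (metis Quotient_abs_rep Quotient_qword surj_def)
  ultimately show ?thesis by simp
qed

lemma qcnj_mult: "qcnj (x * y) = qcnj y * qcnj x"
  by (simp add: quat_eq_iff algebra_simps)

lemma qcnj_simps [simp]:
  "qcnj 0 = 0" "qcnj 1 = 1" "qcnj (x + y) = qcnj x + qcnj y" "qcnj (r *\<^sub>R x) = r *\<^sub>R qcnj x"
  "qcnj (qcnj x) = x"
  by (simp_all add: quat_eq_iff)

lemma word_eval_0 [simp]: "word_eval a 0 = 1"
  by transfer (simp add: list_eval_def)

lemma word_eval_add: "word_eval a (u + v) = word_eval a u * word_eval a v"
  by transfer (simp add: list_eval_def)

lemma word_eval_letter [simp]: "word_eval a (letter_word x) = letter_eval a x"
  by transfer (simp add: list_eval_def)

lemma letter_eval_bar_qcnj: "letter_eval a (bar x) = qcnj (letter_eval a x)"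
  by (cases x) (simp_all add: quat_eq_iff)

lemma word_eval_star: "word_eval a (word_star w) = qcnj (word_eval a w)"
  by (induct w) (simp_all add: word_star_add word_eval_add letter_eval_bar_qcnj qcnj_mult)

lemma falg_star_0 [simp]: "falg_star 0 = 0"
  by (simp add: falg_star_def)

lemma falg_star_single [simp]: "falg_star (Poly_Mapping.single w r) = Poly_Mapping.single (word_star w) r"
  by (simp add: falg_star_def)

lemma falg_star_add [simp]: "falg_star (p + q) = falg_star p + falg_star q"
  unfolding falg_star_def by (rule setsum_keys_plus_distrib) (simp_all add: single_add)

lemma falg_star_uminus [simp]: "falg_star (- p) = - falg_star p"
  by (metis add.right_inverse add_eq_0_iff falg_star_0 falg_star_add)

lemma falg_star_diff [simp]: "falg_star (p - q) = falg_star p - falg_star q"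
  using falg_star_add[of p "- q"] by simp

lemma falg_star_sum: "falg_star (\<Sum>i\<in>A. f i) = (\<Sum>i\<in>A. falg_star (f i))"
  by (induction A rule: infinite_finite_induct) auto

lemma falg_star_star [simp]: "falg_star (falg_star p) = p"
  by (induction p rule: poly_mapping_add_single_induct) auto

lemma falg_star_1 [simp]: "falg_star 1 = 1"
  by (metis falg_star_single single_one word_star_0)

lemma falg_star_mult [simp]: "falg_star (p * q) = falg_star q * falg_star p"
proof (induction p rule: poly_mapping_add_single_induct)
  case (add p w r)
  have "falg_star (Poly_Mapping.single w r * q) = falg_star q * falg_star (Poly_Mapping.single w r)"
    by (induction q rule: poly_mapping_add_single_induct)
      (simp_all add: mult_single word_star_add distrib_left distrib_right mult.commute)
  with add show ?case by (simp add: distrib_left distrib_right)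
qed simp

lemma const_commute: "p * const r = const r * p"
  by (induction p rule: poly_mapping_add_single_induct)
    (simp_all add: mult_single distrib_left distrib_right mult.commute)

lemma falg_eval_0 [simp]: "falg_eval 0 a = 0"
  by (simp add: falg_eval_def)

lemma falg_eval_single [simp]: "falg_eval (Poly_Mapping.single w r) a = r *\<^sub>R word_eval a w"
  by (simp add: falg_eval_def)

lemma falg_eval_add: "falg_eval (p + q) a = falg_eval p a + falg_eval q a"
  unfolding falg_eval_def by (rule setsum_keys_plus_distrib) (simp_all add: scaleR_left_distrib)

lemma falg_eval_diff: "falg_eval (p - q) a = falg_eval p a - falg_eval q a"
  by (metis add_diff_cancel_right' diff_add_cancel falg_eval_add)

lemma falg_eval_mult: "falg_eval (p * q) a = falg_eval p a * falg_eval q a"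
proof (induction p rule: poly_mapping_add_single_induct)
  case (add p w r)
  have "falg_eval (Poly_Mapping.single w r * q) a = r *\<^sub>R word_eval a w * falg_eval q a"
    by (induction q rule: poly_mapping_add_single_induct)
      (simp_all add: mult_single word_eval_add falg_eval_add distrib_left)
  with add show ?case by (simp add: falg_eval_add distrib_right)
qed simp

lemma falg_eval_star: "falg_eval (falg_star p) a = qcnj (falg_eval p a)"
  by (induction p rule: poly_mapping_add_single_induct)
    (simp_all add: falg_eval_add word_eval_star)

lemma riesz_0 [simp]: "riesz y 0 = 0"
  by (simp add: riesz_def)

lemma riesz_single [simp]: "riesz y (Poly_Mapping.single w r) = r * y w"
  by (simp add: riesz_def)

lemma riesz_add: "riesz y (p + q) = riesz y p + riesz y q"
  unfolding riesz_def by (rule setsum_keys_plus_distrib) (simp_all add: distrib_right)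

lemma riesz_const_mult: "riesz y (const r * p) = r * riesz y p"
  by (induction p rule: poly_mapping_add_single_induct)
    (simp_all add: mult_single riesz_add distrib_left)


section \<open>Tracial positive functionals\<close>

text \<open>Log-convexity makes the ratios of successive terms nondecreasing. A first ratio above
  \<open>D\<close> would force geometric growth at a rate above \<open>D\<close>, against the bound
  \<open>A * D ^ k\<close>.\<close>

lemma log_convex_growth:
  fixes s :: "nat \<Rightarrow> real"
  assumes nonneg: "\<And>k. 0 \<le> s k" and convex: "\<And>k. (s (Suc k))\<^sup>2 \<le> s k * s (Suc (Suc k))"
    and growth: "\<And>k. s k \<le> A * D ^ k" and "0 < D"
  shows "s 1 \<le> D * s 0"
proof (rule ccontr)
  assume "\<not> ?thesis"
  then have s1: "D * s 0 < s 1" by simp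
  have s0: "0 < s 0"
  proof (rule ccontr)
    assume "\<not> 0 < s 0"
    then have "s 0 = 0" using nonneg[of 0] by simp
    with convex[of 0] s1 show False by simp
  qed
  define \<rho> where "\<rho> = s 1 / s 0"
  have \<rho>: "D < \<rho>" using s1 s0 by (simp add: \<rho>_def field_simps)
  with \<open>0 < D\<close> have \<rho>0: "0 < \<rho>" by simp
  have step: "0 < s k \<and> \<rho> * s k \<le> s (Suc k)" for k
  proof (induction k)
    case 0
    then show ?case using s0 by (simp add: \<rho>_def)
  next
    case (Suc k)
    then have p: "0 < s k" "\<rho> * s k \<le> s (Suc k)" by auto
    then have p': "0 < s (Suc k)" using \<rho>0 by (meson less_le_trans mult_pos_pos)
    have "\<rho> * s k * s (Suc k) \<le> s (Suc k) * s (Suc k)"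
      using p(2) p' by (intro mult_right_mono) auto
    also have "\<dots> \<le> s k * s (Suc (Suc k))"
      using convex[of k] by (simp add: power2_eq_square)
    finally have "s k * (\<rho> * s (Suc k)) \<le> s k * s (Suc (Suc k))" by (simp add: ac_simps)
    then show ?case using p p' by simp
  qed
  have pow: "\<rho> ^ k * s 0 \<le> s k" for k
  proof (induction k)
    case (Suc k)
    have "\<rho> ^ Suc k * s 0 = \<rho> * (\<rho> ^ k * s 0)" by simp
    also have "\<dots> \<le> \<rho> * s k" using Suc \<rho>0 by (intro mult_left_mono) auto
    finally show ?case using step[of k] by simp
  qed simp
  have "1 < \<rho> / D" using \<rho> \<open>0 < D\<close> by simp
  then obtain k where k: "A / s 0 < (\<rho> / D) ^ k" using real_arch_pow by blast
  have "\<rho> ^ k * s 0 \<le> A * D ^ k" using pow growth order_trans by blast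
  then have "(\<rho> / D) ^ k \<le> A / s 0" using \<open>0 < D\<close> s0 by (simp add: field_simps)
  with k show False by simp
qed

lemma nonneg_quadratic_discriminant:
  fixes a b c :: real
  assumes "\<And>t. 0 \<le> a + 2 * t * b + t\<^sup>2 * c" "0 \<le> c"
  shows "b\<^sup>2 \<le> a * c"
proof (cases "c = 0")
  case True
  have "b = 0"
  proof (rule ccontr)
    assume "b \<noteq> 0"
    \<comment> \<open>At this \<open>t\<close> the remaining affine function takes the value
      -1.\<close>
    with assms(1)[of "- (a + 1) / (2 * b)"] True show False by (simp add: field_simps)
  qed
  with True show ?thesis by simp
next
  case False
  with assms(2) have c: "c > 0" by simp
  \<comment> \<open>The quadratic attains its minimum at -b/c.\<close>
  have "a + 2 * (- b / c) * b + (- b / c)\<^sup>2 * c = (a * c - b\<^sup>2) / c"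
    using c by (simp add: field_simps power2_eq_square)
  with assms(1)[of "- b / c"] c show ?thesis by (simp add: zero_le_divide_iff)
qed

section \<open>Functionals for which symmetric elements are central\<close>

lemma Sym_iff: "c \<in> Sym \<longleftrightarrow> falg_star c = c"
  by (simp add: Sym_def)

text \<open>Hiding the product with a constant lets rewriting collect scalars in front of all other
  factors.\<close>

definition falg_scale :: "real \<Rightarrow> 'n falg \<Rightarrow> 'n falg" where
  "falg_scale r p = const r * p"

lemma falg_scale_simps [simp]:
  "falg_scale r p * q = falg_scale r (p * q)" "p * falg_scale r q = falg_scale r (p * q)"
  "falg_star (falg_scale r p) = falg_scale r (falg_star p)"
  unfolding falg_scale_def by (simp_all add: mult.assoc const_commute) (metis const_commute mult.assoc)

lemma const_eq_scale: "const r = falg_scale r 1"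
  by (simp add: falg_scale_def)

definition norm_gap :: "real \<Rightarrow> 'n::finite falg" where
  "norm_gap R = const R - (\<Sum>i\<in>UNIV. mon (letter_word (Q i) + letter_word (Qbar i)))"

text \<open>Stated for functionals rather than sequences, because the weighted functionals p -> L(d
  p) have to be instances too. Inserting 1 into \<open>G\<close> makes positivity on squares and on
  constraints one condition. Vanishing on the two-sided ideal of \<open>H\<close> follows from
  \<open>ideal\<close> by the trace.\<close>

locale central_trace =
  fixes G H :: "'n::finite falg set" and L :: "'n falg \<Rightarrow> real"
  assumes G_Sym: "G \<subseteq> Sym"
    and add: "L (p + q) = L p + L q"
    and scale: "L (falg_scale r p) = r * L p"
    and star: "L (falg_star p) = L p"
    and trace: "L (p * q) = L (q * p)"
    and nonneg: "g \<in> insert 1 G \<Longrightarrow> 0 \<le> L (falg_star p * (g * p))"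
    and ideal: "h \<in> H \<Longrightarrow> L (p * h) = 0"
    and central: "c \<in> Sym \<Longrightarrow> L (p * (c * x)) = L (p * (x * c))"
begin

lemma zero [simp]: "L 0 = 0"
  using add[of 0 0] by simp

lemma uminus: "L (- p) = - L p"
  using add[of p "- p"] by simp

lemma diff: "L (p - q) = L p - L q"
  using add[of p "- q"] by (simp add: uminus)

lemma sum: "L (\<Sum>i\<in>A. f i) = (\<Sum>i\<in>A. L (f i))"
  by (induction A rule: infinite_finite_induct) (auto simp: add)

lemma square_nonneg: "0 \<le> L (falg_star p * p)"
  using nonneg[of 1 p] by simp

text \<open>The trace carries the right factor \<open>v\<close> to the front, which leaves
  \<open>c * x\<close> at the end, where \<open>central\<close> applies.\<close>

lemma central_mid: "c \<in> Sym \<Longrightarrow> L (u * (c * (x * v))) = L (u * (x * (c * v)))"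
  using central[of c "v * u" x] trace[of v "u * (c * x)"] trace[of v "u * (x * c)"]
  by (simp add: mult.assoc)

lemma Cauchy_Schwarz:
  assumes g: "g \<in> insert 1 G"
  shows "(L (falg_star p * (g * q)))\<^sup>2 \<le> L (falg_star p * (g * p)) * L (falg_star q * (g * q))"
proof (rule nonneg_quadratic_discriminant)
  have "falg_star g = g" using g G_Sym by (auto simp: Sym_def)
  then have sym: "L (falg_star q * (g * p)) = L (falg_star p * (g * q))"
    using star[of "falg_star q * (g * p)"] by (simp add: mult.assoc)
  show "0 \<le> L (falg_star p * (g * p)) + 2 * t * L (falg_star p * (g * q))
      + t\<^sup>2 * L (falg_star q * (g * q))" for t
    using nonneg[OF g, of "p + falg_scale t q"]
    by (simp add: distrib_left distrib_right add scale sym mult.assoc power2_eq_square)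
qed (rule nonneg[OF g])

lemma square_add_le:
  "L (falg_star (u + v) * (u + v)) \<le> 2 * L (falg_star u * u) + 2 * L (falg_star v * v)"
  using square_nonneg[of "u - v"]
  by (simp add: distrib_left distrib_right left_diff_distrib right_diff_distrib add diff)

lemma eq_zero_if_mass_zero:
  assumes "L 1 = 0"
  shows "L p = 0"
  using Cauchy_Schwarz[of 1 1 p] assms by simp

text \<open>The symmetrized products in the quadratic module are not visibly of the form b* g b.
  Under a central trace they can be brought to it: a sum of squares passes \<open>g\<close>, and
  \<open>p * falg_star p\<close> can be moved between the two factors of a square. This makes the
  Archimedean element usable as one more constraint.\<close>

lemma quad_module_nonneg:
  assumes g: "\<And>i. i \<in> {1..m} \<Longrightarrow> g i \<in> G" and h: "\<And>j. j \<in> {1..l} \<Longrightarrow> h j \<in> H"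
    and q: "q \<in> quad_module m g l h"
  shows "0 \<le> L (falg_star p * (q * p))"
proof -
  obtain \<sigma> and N :: "nat \<Rightarrow> nat" and \<tau> \<nu> where q: "q = \<sigma> 0 + const (1/2) * (\<Sum>i=1..m. \<sigma> i * g i + g i * \<sigma> i)
      + (\<Sum>j=1..l. \<Sum>\<alpha><N j. \<tau> j \<alpha> * h j * \<nu> j \<alpha>
          + falg_star (\<nu> j \<alpha>) * falg_star (h j) * falg_star (\<tau> j \<alpha>))"
    and \<sigma>: "\<forall>i\<le>m. \<sigma> i \<in> SOS"
    using q unfolding quad_module_def mem_Collect_eq by (elim exE conjE) (rule that)
  have SOS: "\<exists>N a. s = (\<Sum>k<(N::nat). falg_star (a k) * a k)" if "s \<in> SOS" for s :: "'n falg"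
    using that unfolding SOS_def by blast
  have \<sigma>0: "0 \<le> L (falg_star p * (\<sigma> 0 * p))"
  proof -
    obtain N a where a: "\<sigma> 0 = (\<Sum>k<(N::nat). falg_star (a k) * a k)" using SOS \<sigma> by blast
    have "0 \<le> L (falg_star p * (falg_star (a k) * a k * p))" for k
      using square_nonneg[of "a k * p"] by (simp add: mult.assoc)
    then show ?thesis unfolding a by (simp add: sum_distrib_left sum_distrib_right sum sum_nonneg)
  qed
  have \<sigma>g: "0 \<le> L (falg_star p * ((\<sigma> i * g i + g i * \<sigma> i) * p))" if i: "i \<in> {1..m}" for i
  proof -
    obtain N a where a: "\<sigma> i = (\<Sum>k<(N::nat). falg_star (a k) * a k)" using SOS \<sigma> i by (meson atLeastAtMost_iff)
    have gi: "g i \<in> G" by (rule g[OF i])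
    have flip: "L (falg_star p * (\<sigma> i * (g i * p))) = L (falg_star p * (g i * (\<sigma> i * p)))"
      unfolding a by (rule central_mid) (simp add: Sym_iff falg_star_sum)
    \<comment> \<open>As \<open>p p\<^sup>*\<close> is central, the value is \<open>L (x\<^sup>* g x)\<close> for \<open>x = b\<^sup>* p\<close>.\<close>
    have "0 \<le> L (falg_star p * (falg_star b * (b * (g i * p))))" for b
    proof -
      have "p * falg_star p \<in> Sym" by (simp add: Sym_iff)
      from central_mid[OF this, of "g i" "falg_star b" b]
      have "L (g i * (p * (falg_star p * (falg_star b * b)))) = L (g i * (falg_star b * (p * (falg_star p * b))))"
        by (simp add: mult.assoc)
      moreover have "L (falg_star p * (falg_star b * (b * (g i * p)))) = L (g i * (p * (falg_star p * (falg_star b * b))))"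
        using trace[of "falg_star p * (falg_star b * b)" "g i * p"] by (simp add: mult.assoc)
      moreover have "L (g i * (falg_star b * (p * (falg_star p * b)))) = L (falg_star (falg_star b * p) * (g i * (falg_star b * p)))"
        using trace[of "falg_star p * b" "g i * (falg_star b * p)"] by (simp add: mult.assoc)
      ultimately show ?thesis using nonneg[of "g i" "falg_star b * p"] gi by simp
    qed
    then have "0 \<le> L (falg_star p * (\<sigma> i * (g i * p)))"
      unfolding a by (simp add: sum_distrib_left sum_distrib_right sum sum_nonneg mult.assoc)
    then show ?thesis using flip by (simp add: distrib_left distrib_right add mult.assoc)
  qed
  have \<tau>: "L (falg_star p * ((u * h j * v + falg_star v * falg_star (h j) * falg_star u) * p)) = 0"
    if j: "j \<in> {1..l}" for j u v
  proof -
    have "L (falg_star p * (u * (h j * (v * p)))) = 0"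
      using ideal[OF h[OF j], of "v * (p * (falg_star p * u))"] trace[of "falg_star p * (u * h j)" "v * p"]
      by (simp add: mult.assoc)
    moreover from this have "L (falg_star p * (falg_star v * (falg_star (h j) * (falg_star u * p)))) = 0"
      using star[of "falg_star p * (u * (h j * (v * p)))"] by (simp add: mult.assoc)
    ultimately show ?thesis by (simp add: distrib_left distrib_right add mult.assoc)
  qed
  have "L (falg_star p * (q * p)) = L (falg_star p * (\<sigma> 0 * p))
      + 1/2 * (\<Sum>i=1..m. L (falg_star p * ((\<sigma> i * g i + g i * \<sigma> i) * p)))
      + (\<Sum>j=1..l. \<Sum>\<alpha><N j. L (falg_star p * ((\<tau> j \<alpha> * h j * \<nu> j \<alpha>
          + falg_star (\<nu> j \<alpha>) * falg_star (h j) * falg_star (\<tau> j \<alpha>)) * p)))"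
    unfolding q const_eq_scale
    by (simp only: distrib_right[of _ _ p] distrib_left[of "falg_star p"] add falg_scale_simps mult_1 scale
        sum_distrib_right[of _ _ p] sum_distrib_left[of "falg_star p"] sum)
  also have "\<dots> \<ge> 0"
    using \<sigma>0 sum_nonneg[of "{1..m}", OF \<sigma>g] by (simp add: \<tau>)
  finally show ?thesis .
qed

end

text \<open>\<open>R\<close> is a parameter independent of \<open>L\<close>, so constants derived
  from it can serve all functionals at once. Listing the gap among the constraints lets weighted
  functionals inherit it.\<close>

locale tracial_positive = central_trace G H L
  for R :: real and G H :: "'n::finite falg set" and L :: "'n falg \<Rightarrow> real" +
  assumes R_nonneg: "0 \<le> R" and gap_in_G: "norm_gap R \<in> G"
begin

text \<open>Each L(p* |q_i|^2 p) is a nonnegative summand of a total that positivity on the gap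
  bounds by R L(p* p). Both letters are covered because q_i commutes with its conjugate.\<close>

lemma letter_bound:
  "L (falg_star (mon (letter_word x) * p) * (mon (letter_word x) * p)) \<le> R * L (falg_star p * p)"
proof -
  let ?M = "\<lambda>i. mon (letter_word (Q i) + letter_word (Qbar i)) :: 'n falg"
  let ?T = "\<lambda>i. L (falg_star p * (?M i * p))"
  have T: "?T i = L (falg_star (mon (letter_word (Qbar i)) * p) * (mon (letter_word (Qbar i)) * p))" for i
    by (simp add: mult_single flip: mult.assoc) (simp add: mult_single mult.assoc)
  have T': "?T i = L (falg_star (mon (letter_word (Q i)) * p) * (mon (letter_word (Q i)) * p))" for i
    using letter_word_bar_commute[of "Q i"]
    by (simp add: mult_single flip: mult.assoc) (simp add: mult_single mult.assoc)
  have "?T i \<ge> 0" for i by (subst T) (rule square_nonneg)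
  then have "?T (idx x) \<le> (\<Sum>i\<in>UNIV. ?T i)" by (intro member_le_sum) auto
  also have "\<dots> = R * L (falg_star p * p) - L (falg_star p * (norm_gap R * p))"
    by (simp add: norm_gap_def left_diff_distrib right_diff_distrib diff sum_distrib_left sum_distrib_right
        sum const_eq_scale scale)
  also have "\<dots> \<le> R * L (falg_star p * p)"
    using nonneg[of "norm_gap R" p] gap_in_G by simp
  finally show ?thesis using T T' by (cases x) auto
qed

text \<open>A symmetric weight moves freely under \<open>L\<close>, so the trace, the involution,
  the ideal and centrality carry over; positivity is what has to be supplied.\<close>

lemma weighted:
  assumes d: "d \<in> Sym" and pos: "\<And>g p. g \<in> insert 1 G \<Longrightarrow> 0 \<le> L (falg_star p * (g * (d * p)))"
  shows "tracial_positive R G H (\<lambda>p. L (d * p))"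
proof
  have ds: "falg_star d = d" using d by (simp add: Sym_iff)
  show "0 \<le> R" "G \<subseteq> Sym" "norm_gap R \<in> G" by (fact R_nonneg G_Sym gap_in_G)+
  show "L (d * (p + q)) = L (d * p) + L (d * q)" for p q
    by (simp add: distrib_left add)
  show "L (d * falg_scale r p) = r * L (d * p)" for r p
    by (simp add: scale)
  show "L (d * falg_star p) = L (d * p)" for p
    using star[of "p * d"] trace[of p d] by (simp add: ds)
  show "L (d * (p * q)) = L (d * (q * p))" for p q
    using trace[of d "p * q"] central[OF d, of p q] trace[of p "d * q"] by (simp add: mult.assoc)
  show "L (d * (p * h)) = 0" if "h \<in> H" for h p
    using ideal[OF that, of "d * p"] by (simp add: mult.assoc)
  show "L (d * (p * (c * x))) = L (d * (p * (x * c)))" if "c \<in> Sym" for c p x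
    using central[OF that, of "d * p" x] by (simp add: mult.assoc)
  show "0 \<le> L (d * (falg_star p * (g * p)))" if "g \<in> insert 1 G" for g p
    using pos[OF that, of p] trace[of d "falg_star p * (g * p)"] central[OF d, of "falg_star p * g" p]
    by (simp add: mult.assoc)
qed

end

text \<open>Bounds multiply along a word by \<open>letter_bound\<close> and combine over a sum by
  \<open>square_add_le\<close>. The constant precedes the functional; this uniformity later bounds
  each coordinate over all states.\<close>

lemma mult_bounded:
  fixes c :: "'n::finite falg"
  shows "\<exists>C>0. \<forall>L p. tracial_positive R G H L \<longrightarrow>
    L (falg_star (c * p) * (c * p)) \<le> C * L (falg_star p * p)"
proof (induction c rule: poly_mapping_add_single_induct)
  case zero
  have "L (falg_star (0 * p) * (0 * p)) \<le> 1 * L (falg_star p * p)"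
    if L: "tracial_positive R G H L" for L p
  proof -
    interpret tracial_positive R G H L by fact
    show ?thesis by (simp add: square_nonneg)
  qed
  then show ?case by (intro exI[of _ 1]) auto
next
  case (add c w r)
  have word: "\<exists>C\<ge>0. \<forall>L p. tracial_positive R G H L \<longrightarrow>
    L (falg_star (mon w * p) * (mon w * p)) \<le> C * L (falg_star p * p)" for w :: "'n qword"
  proof (induct w)
    case zero
    show ?case by (intro exI[of _ 1]) simp
  next
    case (add x w)
    then obtain C where C: "C \<ge> 0" "\<And>L p. tracial_positive R G H L \<Longrightarrow>
      L (falg_star (mon w * p) * (mon w * p)) \<le> C * L (falg_star p * p)" by blast
    \<comment> \<open>The absolute value keeps the constant nonnegative before any functional is
      given from which 0 <= R could be drawn.\<close>
    have "L (falg_star (mon (letter_word x + w) * p) * (mon (letter_word x + w) * p))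
      \<le> (\<bar>R\<bar> * C) * L (falg_star p * p)" if L: "tracial_positive R G H L" for L p
    proof -
      interpret tracial_positive R G H L by fact
      have "mon (letter_word x + w) * p = mon (letter_word x) * (mon w * p)"
        by (simp add: mult_single flip: mult.assoc)
      then have "L (falg_star (mon (letter_word x + w) * p) * (mon (letter_word x + w) * p))
        \<le> R * L (falg_star (mon w * p) * (mon w * p))"
        using letter_bound[of x "mon w * p"] by simp
      also have "\<dots> \<le> R * (C * L (falg_star p * p))"
        using C(2)[OF L] R_nonneg by (intro mult_left_mono) auto
      finally show ?thesis using R_nonneg by (simp add: mult.assoc)
    qed
    then show ?case using C(1) by (intro exI[of _ "\<bar>R\<bar> * C"]) simp
  qed
  obtain C where C: "C > 0" "\<And>L p. tracial_positive R G H L \<Longrightarrow>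
    L (falg_star (c * p) * (c * p)) \<le> C * L (falg_star p * p)" using add by blast
  obtain B where B: "B \<ge> 0" "\<And>L p. tracial_positive R G H L \<Longrightarrow>
    L (falg_star (mon w * p) * (mon w * p)) \<le> B * L (falg_star p * p)" using word by blast
  let ?c = "c + Poly_Mapping.single w r"
  have "L (falg_star (?c * p) * (?c * p)) \<le> (2 * C + 2 * r\<^sup>2 * B) * L (falg_star p * p)"
    if L: "tracial_positive R G H L" for L p
  proof -
    interpret tracial_positive R G H L by fact
    have s: "Poly_Mapping.single w r = falg_scale r (mon w)" by (simp add: falg_scale_def mult_single)
    have "L (falg_star (falg_scale r (mon w) * p) * (falg_scale r (mon w) * p))
      = r\<^sup>2 * L (falg_star (mon w * p) * (mon w * p))"
      by (simp add: scale power2_eq_square)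
    also have "\<dots> \<le> r\<^sup>2 * (B * L (falg_star p * p))"
      using B(2)[OF L] by (intro mult_left_mono) auto
    finally have "L (falg_star (?c * p) * (?c * p))
        \<le> 2 * (C * L (falg_star p * p)) + 2 * (r\<^sup>2 * (B * L (falg_star p * p)))"
      using square_add_le[of "c * p" "falg_scale r (mon w) * p"] C(2)[OF L, of p]
      unfolding s distrib_right by linarith
    also have "\<dots> = (2 * C + 2 * r\<^sup>2 * B) * L (falg_star p * p)"
      by (simp add: distrib_right mult.assoc)
    finally show ?thesis .
  qed
  then show ?case using C(1) B(1) by (intro exI[of _ "2 * C + 2 * r\<^sup>2 * B"]) (simp add: add_pos_nonneg)
qed

lemma Sym_power: "c \<in> Sym \<Longrightarrow> c ^ k \<in> Sym"
  by (induction k) (simp_all add: Sym_iff power_commutes)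

text \<open>The numbers \<open>L (p\<^sup>* g c\<^sup>2\<^sup>k p)\<close> are log-convex in \<open>k\<close> and grow at most like \<open>C\<^sup>k\<close>; this bounds
  their first ratio.\<close>

lemma square_mult_bounded:
  fixes c :: "'n::finite falg"
  assumes c: "c \<in> Sym"
  shows "\<exists>C>0. \<forall>L g p. tracial_positive R G H L \<longrightarrow> g \<in> insert 1 G \<longrightarrow>
    L (falg_star p * (g * (c * (c * p)))) \<le> C * L (falg_star p * (g * p))"
proof -
  obtain C where C: "C > 0" "\<And>L p. tracial_positive R G H L \<Longrightarrow>
    L (falg_star (c * p) * (c * p)) \<le> C * L (falg_star p * p)" using mult_bounded by blast
  have "L (falg_star p * (g * (c * (c * p)))) \<le> C * L (falg_star p * (g * p))"
    if L: "tracial_positive R G H L" and g: "g \<in> insert 1 G" for L g p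
  proof -
    interpret tracial_positive R G H L by fact
    have gs: "falg_star g = g" using g G_Sym by (auto simp: Sym_def)
    have cs: "falg_star (c ^ k) = c ^ k" for k using Sym_power[OF c] by (simp add: Sym_iff)
    define s where "s i = L (falg_star p * (g * (c ^ i * p)))" for i
    have s_add: "L (falg_star (c ^ i * p) * (g * (c ^ j * p))) = s (i + j)" for i j
    proof -
      have "L (falg_star (c ^ i * p) * (g * (c ^ j * p))) = L (falg_star p * (c ^ i * (g * (c ^ j * p))))"
        by (simp add: cs mult.assoc)
      also have "\<dots> = L (falg_star p * (g * (c ^ i * (c ^ j * p))))"
        by (rule central_mid) (rule Sym_power[OF c])
      finally show ?thesis by (simp add: s_def power_add mult.assoc)
    qed
    have pow: "L (falg_star (c ^ k * p) * (c ^ k * p)) \<le> C ^ k * L (falg_star p * p)" for k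
    proof (induction k)
      case (Suc k)
      have "L (falg_star (c ^ Suc k * p) * (c ^ Suc k * p)) \<le> C * L (falg_star (c ^ k * p) * (c ^ k * p))"
        using C(2)[OF L, of "c ^ k * p"] by (simp add: mult.assoc)
      also have "\<dots> \<le> C * (C ^ k * L (falg_star p * p))"
        using Suc C(1) by (intro mult_left_mono) auto
      finally show ?case by (simp add: mult.assoc)
    qed simp
    define A where "A = L (falg_star (g * p) * (g * p)) * L (falg_star p * p)"
    have A: "A \<ge> 0" unfolding A_def by (intro mult_nonneg_nonneg square_nonneg)
    have sqrt_eq: "0 \<le> u * v \<Longrightarrow> u * (C ^ (2 * k) * v) = (sqrt (u * v) * C ^ k)\<^sup>2" for u v k
      by (simp add: power_mult_distrib power_even_eq)
    \<comment> \<open>Cauchy-Schwarz is taken for weight 1, with \<open>g\<close> absorbed into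
      \<open>g * p\<close>, since \<open>C\<close> controls multiplication by \<open>c\<close> for
      that form.\<close>
    have growth: "s (2 * k) \<le> sqrt A * C ^ k" for k
    proof -
      have "(s (2 * k))\<^sup>2 \<le> L (falg_star (g * p) * (g * p)) * L (falg_star (c ^ (2 * k) * p) * (c ^ (2 * k) * p))"
        using Cauchy_Schwarz[of 1 "g * p" "c ^ (2 * k) * p"] by (simp add: s_def gs mult.assoc)
      also have "\<dots> \<le> L (falg_star (g * p) * (g * p)) * (C ^ (2 * k) * L (falg_star p * p))"
        by (intro mult_left_mono pow square_nonneg)
      also have "\<dots> = (sqrt A * C ^ k)\<^sup>2"
        unfolding A_def using A[unfolded A_def] by (rule sqrt_eq)
      finally show ?thesis
        by (rule power2_le_imp_le) (intro mult_nonneg_nonneg real_sqrt_ge_zero A zero_le_power less_imp_le C(1))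
    qed
    \<comment> \<open>At even indices \<open>s (2 * k)\<close> is the \<open>g\<close>-form
      evaluated at c^k p, hence nonnegative; log-convexity is Cauchy-Schwarz for c^k p and c^(k+2)
      p.\<close>
    have "s (2 * 1) \<le> C * s (2 * 0)"
    proof (rule log_convex_growth[of "\<lambda>k. s (2 * k)"])
      show "0 \<le> s (2 * k)" for k
        using nonneg[OF g, of "c ^ k * p"] unfolding s_add mult_2 .
      show "(s (2 * Suc k))\<^sup>2 \<le> s (2 * k) * s (2 * Suc (Suc k))" for k
        using Cauchy_Schwarz[OF g, of "c ^ k * p" "c ^ Suc (Suc k) * p"] unfolding s_add
        by (simp only: mult_2 add_Suc add_Suc_right)
    qed (rule growth C(1))+
    moreover have "c ^ (2 * 1) * p = c * (c * p)" by (simp add: power2_eq_square mult.assoc)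
    ultimately show ?thesis by (simp only: s_def mult_0_right power_0 mult_1)
  qed
  with C(1) show ?thesis by blast
qed


section \<open>Multiplicative functionals are point evaluations\<close>

definition skew :: "'n falg \<Rightarrow> bool" where
  "skew x \<longleftrightarrow> falg_star x = - x"

locale tracial_character = tracial_positive +
  assumes unit: "L 1 = 1" and mult: "c \<in> Sym \<Longrightarrow> L (c * p) = L c * L p"
begin

lemma Sym_scalar: "c \<in> Sym \<Longrightarrow> L (u * (c * v)) = L c * L (u * v)"
  using central[of c u v] trace[of "u * v" c] trace[of u "v * c"] mult[of c "u * v"] by (simp add: mult.assoc)

lemma skew_zero: "skew x \<Longrightarrow> L x = 0"
  using star[of x] by (simp add: skew_def uminus)

text \<open>The anticommutator of two skew elements is symmetric and so acts as the scalar 2 L(x y).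
  Skew elements thus obey Clifford relations for the form L(x y), which is negative
  semidefinite.\<close>

lemma skew_anticommute:
  assumes "skew x" "skew y"
  shows "L (u * (x * (y * v))) = 2 * L (x * y) * L (u * v) - L (u * (y * (x * v)))"
proof -
  have "x * y + y * x \<in> Sym" using assms by (simp add: Sym_iff skew_def add.commute)
  from Sym_scalar[OF this, of u v] show ?thesis
    using trace[of x y] by (simp add: add distrib_left distrib_right mult.assoc)
qed

lemma skew_square:
  assumes "skew x"
  shows "L (u * (x * (x * v))) = L (x * x) * L (u * v)"
  using skew_anticommute[OF assms assms, of u v] by simp

lemma skew_square_nonpos: "skew x \<Longrightarrow> L (x * x) \<le> 0"
  using square_nonneg[of x] by (simp add: skew_def uminus)

lemma skew_null:
  assumes "skew x" "L (x * x) = 0"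
  shows "L (u * x) = 0"
  using Cauchy_Schwarz[of 1 "falg_star u" x] assms by (simp add: skew_def uminus)

lemma skew_star: "skew e \<Longrightarrow> L (e * falg_star p) = - L (e * p)"
  using star[of "e * falg_star p"] trace[of p e] by (simp add: skew_def uminus)

text \<open>The symmetric part of \<open>p\<close> acts as a scalar, and this scalar is
  \<open>L p\<close> because \<open>L\<close> is invariant under the involution.\<close>

lemma skew_split: "L (u * p) = L p * L u + L (u * (p - falg_star p)) / 2"
proof -
  have "p + falg_star p \<in> Sym" by (simp add: Sym_iff add.commute)
  from Sym_scalar[OF this, of u 1] show ?thesis
    by (simp add: distrib_left right_diff_distrib add diff star field_simps)
qed

lemma skew_diff_star: "skew (p - falg_star p)"
  by (simp add: skew_def)

lemma skew_closed:
  "skew x \<Longrightarrow> skew y \<Longrightarrow> skew (x + y)" "skew x \<Longrightarrow> skew (falg_scale r x)"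
  "skew x \<Longrightarrow> skew y \<Longrightarrow> skew (x * y - y * x)"
  by (simp_all add: skew_def) (simp add: falg_scale_def)

lemma skew_normalize:
  assumes "skew x" "L (x * x) \<noteq> 0"
  obtains r where "skew (falg_scale r x)" "L (falg_scale r x * falg_scale r x) = -1"
proof
  let ?r = "1 / sqrt (- L (x * x))"
  show "skew (falg_scale ?r x)" using assms by (intro skew_closed)
  have "L (x * x) < 0" using skew_square_nonpos[OF assms(1)] assms(2) by simp
  then show "L (falg_scale ?r x * falg_scale ?r x) = -1"
    by (simp add: scale flip: mult.assoc)
qed

text \<open>The core of Frobenius' theorem. Half the commutator is chosen for \<open>e3\<close>
  because it is exactly skew, while it agrees with \<open>e1 * e2\<close> only under
  \<open>L\<close>. All relations are stated under \<open>L\<close>, that is, modulo null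
  elements.\<close>

lemma quaternion_triple_span:
  assumes e1: "skew e1" "L (e1 * e1) = -1" and e2: "skew e2" "L (e2 * e2) = -1"
    and orth: "L (e1 * e2) = 0"
  obtains e3 where "skew e3"
    "\<And>p. L (e1 * (e2 * p)) = L (e3 * p)" "\<And>p. L (e2 * (e1 * p)) = - L (e3 * p)"
    "\<And>p. L (e2 * (e3 * p)) = L (e1 * p)" "\<And>p. L (e3 * (e2 * p)) = - L (e1 * p)"
    "\<And>p. L (e3 * (e1 * p)) = L (e2 * p)" "\<And>p. L (e1 * (e3 * p)) = - L (e2 * p)"
    "\<And>p. L (e3 * (e3 * p)) = - L p"
    "\<And>x u. skew x \<Longrightarrow> L (u * x) = - (L (e1 * x) * L (u * e1) + L (e2 * x) * L (u * e2) + L (e3 * x) * L (u * e3))"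
proof
  define e3 where "e3 = falg_scale (1/2) (e1 * e2 - e2 * e1)"
  show s3: "skew e3" unfolding e3_def by (intro skew_closed e1 e2)
  have flip: "L (u * (e2 * (e1 * v))) = - L (u * (e1 * (e2 * v)))" for u v
    using skew_anticommute[OF e1(1) e2(1), of u v] orth by simp
  have sq1: "L (u * (e1 * (e1 * v))) = - L (u * v)" and sq2: "L (u * (e2 * (e2 * v))) = - L (u * v)" for u v
    using skew_square[OF e1(1)] skew_square[OF e2(1)] e1 e2 by simp_all
  have e3: "L (u * (e3 * v)) = L (u * (e1 * (e2 * v)))" for u v
    using flip[of u v]
    by (simp add: e3_def left_diff_distrib right_diff_distrib diff scale mult.assoc)
  show e12: "L (e1 * (e2 * p)) = L (e3 * p)" for p using e3[of 1 p] by simp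
  show e21: "L (e2 * (e1 * p)) = - L (e3 * p)" for p using flip[of 1 p] e12 by simp
  show e23: "L (e2 * (e3 * p)) = L (e1 * p)" for p
    using e3[of e2 p] flip[of 1 "e2 * p"] sq2[of e1 p] by simp
  show e32: "L (e3 * (e2 * p)) = - L (e1 * p)" for p
    using e3[of 1 "e2 * p"] sq2[of e1 p] by simp
  show e31: "L (e3 * (e1 * p)) = L (e2 * p)" for p
    using e3[of 1 "e1 * p"] flip[of e1 p] sq1[of 1 "e2 * p"] by simp
  show e13: "L (e1 * (e3 * p)) = - L (e2 * p)" for p
    using e3[of e1 p] sq1[of 1 "e2 * p"] by simp
  show e33: "L (e3 * (e3 * p)) = - L p" for p
    using e3[of e3 p] e31[of "e2 * p"] sq2[of 1 p] by simp
  have null: "L (u * x) = 0"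
    if x: "skew x" "L (e1 * x) = 0" "L (e2 * x) = 0" "L (e3 * x) = 0" for x u
  proof -
    have a: "L (u * (x * (e1 * v))) = - L (u * (e1 * (x * v)))"
      "L (u * (x * (e2 * v))) = - L (u * (e2 * (x * v)))"
      "L (u * (x * (e3 * v))) = - L (u * (e3 * (x * v)))" for u v
      using skew_anticommute[OF e1(1) x(1), of u v] skew_anticommute[OF e2(1) x(1), of u v]
        skew_anticommute[OF s3 x(1), of u v] x by simp_all
    \<comment> \<open>Being \<open>e1 e2\<close>, the element \<open>e3\<close> commutes with \<open>x\<close>; being orthogonal to \<open>x\<close>, it anticommutes with it.\<close>
    have "L (u * (x * (e3 * v))) = L (u * (e3 * (x * v)))" for u v
      using e3[of "u * x" v] a(1)[of u "e2 * v"] a(2)[of "u * e1" v] e3[of u "x * v"]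
      by (simp add: mult.assoc)
    with a(3) have "L (u * (e3 * (x * v))) = 0" for u v
      by (metis equal_neg_zero)
    from this[of e3 x] have "L (x * x) = 0" by (simp add: e33)
    with x(1) show ?thesis by (rule skew_null)
  qed
  show "L (u * x) = - (L (e1 * x) * L (u * e1) + L (e2 * x) * L (u * e2) + L (e3 * x) * L (u * e3))"
    if x: "skew x" for x u
  proof -
    have o: "L (e1 * e3) = 0" "L (e3 * e1) = 0" "L (e2 * e3) = 0" "L (e3 * e2) = 0"
      "L (e2 * e1) = 0" "L (e3 * e3) = -1"
      using e13[of 1] e31[of 1] e23[of 1] e32[of 1] e33[of 1] skew_zero[OF e1(1)] skew_zero[OF e2(1)]
        skew_zero[OF s3] orth trace[of e1 e2] unit by simp_all
    \<comment> \<open>Gram-Schmidt: the components along the triple are removed by adding, since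
      each of its members has square -1.\<close>
    let ?x = "x + falg_scale (L (e1 * x)) e1 + falg_scale (L (e2 * x)) e2 + falg_scale (L (e3 * x)) e3"
    have "L (u * ?x) = 0"
      by (rule null) (simp_all add: skew_closed x e1(1) e2(1) s3 distrib_left add scale o orth e1(2) e2(2))
    then show ?thesis by (simp add: distrib_left add scale)
  qed
qed

text \<open>The three cases correspond to the skew elements having dimension 0, 1 or 3 modulo null elements.\<close>

lemma quaternion_representation:
  obtains \<pi> where "\<And>p. qRe (\<pi> p) = L p" "\<pi> 1 = 1" "\<And>p q. \<pi> (p + q) = \<pi> p + \<pi> q"
    "\<And>r p. \<pi> (falg_scale r p) = r *\<^sub>R \<pi> p" "\<And>p q. \<pi> (p * q) = \<pi> p * \<pi> q"
    "\<And>p. \<pi> (falg_star p) = qcnj (\<pi> p)" "\<And>p. (\<And>u. L (u * p) = 0) \<Longrightarrow> \<pi> p = 0"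
proof -
  consider (real) "\<And>x. skew x \<Longrightarrow> L (x * x) = 0"
    | (complex) e where "skew e" "L (e * e) = -1" "\<And>x. skew x \<Longrightarrow> L (e * x) = 0 \<Longrightarrow> L (x * x) = 0"
    | (quaternion) e1 e2 where "skew e1" "L (e1 * e1) = -1" "skew e2" "L (e2 * e2) = -1" "L (e1 * e2) = 0"
  proof (cases "\<forall>x. skew x \<longrightarrow> L (x * x) = 0")
    case False
    then obtain x where "skew x" "L (x * x) \<noteq> 0" by blast
    from skew_normalize[OF this] obtain r where e: "skew (falg_scale r x)" "L (falg_scale r x * falg_scale r x) = -1"
      by blast
    define e where "e = falg_scale r x"
    note e = e[folded e_def]
    show ?thesis
    proof (cases "\<forall>x. skew x \<longrightarrow> L (e * x) = 0 \<longrightarrow> L (x * x) = 0")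
      case False
      then obtain z where z: "skew z" "L (e * z) = 0" "L (z * z) \<noteq> 0" by blast
      from skew_normalize[OF z(1,3)] obtain t where t: "skew (falg_scale t z)" "L (falg_scale t z * falg_scale t z) = -1"
        by blast
      have "L (e * falg_scale t z) = 0" using z(2) by (simp add: scale)
      from quaternion[OF e t this] show ?thesis .
    qed (use complex[OF e] in blast)
  qed (use real in blast)
  then show ?thesis
  proof cases
    case real
    have e: "L (p * q) = L p * L q" for p q
      using skew_split[of p q] skew_null[OF skew_diff_star real[OF skew_diff_star], of p q] by simp
    show ?thesis
    proof (rule that[of "\<lambda>p. Quat (L p) 0 0 0"])
      fix p assume "\<And>u. L (u * p) = 0"
      from this[of 1] show "Quat (L p) 0 0 0 = 0" by (simp add: quat_eq_iff)
    qed (simp_all add: quat_eq_iff unit add scale e star)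
  next
    case (complex j)
    have oj: "L j = 0" by (rule skew_zero) fact
    have x: "L (u * x) = - L (j * x) * L (u * j)" if "skew x" for u x
    proof -
      let ?x = "x + falg_scale (L (j * x)) j"
      have s: "skew ?x" by (intro skew_closed that complex(1))
      have "L (?x * ?x) = 0"
        by (rule complex(3)[OF s]) (simp add: distrib_left add scale complex(2))
      from skew_null[OF s this, of u] show ?thesis by (simp add: distrib_left add scale)
    qed
    have e: "L (u * p) = L p * L u - L (j * p) * L (u * j)" for u p
      using skew_split[of u p] x[OF skew_diff_star, of u p] skew_star[OF complex(1), of p]
      by (simp add: right_diff_distrib diff)
    have jj: "L (j * (j * p)) = - L p" for p
      using skew_square[OF complex(1), of 1 p] complex(2) by simp
    have jpj: "L (j * (p * j)) = - L p" for p
      using trace[of j "p * j"] trace[of "p * j" j] trace[of p "j * j"] jj[of p] by (simp add: mult.assoc)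
    have pj: "L (p * j) = L (j * p)" for p by (rule trace)
    show ?thesis
    \<comment> \<open>As L(j j) = -1, the coordinate of \<open>p\<close> along \<open>j\<close> is -
      L(j p). The quaternionic case has the same signs.\<close>
    proof (rule that[of "\<lambda>p. Quat (L p) (- L (j * p)) 0 0"])
      fix p assume a: "\<And>u. L (u * p) = 0"
      from a[of 1] a[of j] show "Quat (L p) (- L (j * p)) 0 0 = 0" by (simp add: quat_eq_iff)
    next
      fix p q
      have "L (p * q) = L p * L q - L (j * p) * L (j * q)"
        using e[of p q] pj[of p] by simp
      moreover have "L (j * (p * q)) = L p * L (j * q) + L (j * p) * L q"
        using e[of "j * p" q] jpj[of p] by (simp add: mult.assoc)
      ultimately show "Quat (L (p * q)) (- L (j * (p * q))) 0 0
        = Quat (L p) (- L (j * p)) 0 0 * Quat (L q) (- L (j * q)) 0 0"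
        by (simp add: quat_eq_iff)
    qed (simp_all add: quat_eq_iff unit add scale star oj distrib_left skew_star complex(1))
  next
    case (quaternion e1 e2)
    obtain e3 where s3: "skew e3"
      and tab: "\<And>p. L (e1 * (e2 * p)) = L (e3 * p)" "\<And>p. L (e2 * (e1 * p)) = - L (e3 * p)"
        "\<And>p. L (e2 * (e3 * p)) = L (e1 * p)" "\<And>p. L (e3 * (e2 * p)) = - L (e1 * p)"
        "\<And>p. L (e3 * (e1 * p)) = L (e2 * p)" "\<And>p. L (e1 * (e3 * p)) = - L (e2 * p)"
        "\<And>p. L (e3 * (e3 * p)) = - L p"
      and x: "\<And>x u. skew x \<Longrightarrow> L (u * x) = - (L (e1 * x) * L (u * e1) + L (e2 * x) * L (u * e2) + L (e3 * x) * L (u * e3))"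
      using quaternion_triple_span[OF quaternion] by blast
    have tab': "L (e1 * (e1 * p)) = - L p" "L (e2 * (e2 * p)) = - L p" for p
      using skew_square[OF quaternion(1), of 1 p] skew_square[OF quaternion(3), of 1 p] quaternion by simp_all
    have zero: "L e1 = 0" "L e2 = 0" "L e3 = 0"
      using quaternion s3 by (simp_all add: skew_zero)
    have e: "L (u * p) = L p * L u - (L (e1 * p) * L (e1 * u) + L (e2 * p) * L (e2 * u) + L (e3 * p) * L (e3 * u))" for u p
      using skew_split[of u p] x[OF skew_diff_star, of u p] skew_star[OF quaternion(1), of p]
        skew_star[OF quaternion(3), of p] skew_star[OF s3, of p] trace[of u e1] trace[of u e2] trace[of u e3]
      by (simp add: right_diff_distrib diff)
    let ?\<pi> = "\<lambda>p. Quat (L p) (- L (e1 * p)) (- L (e2 * p)) (- L (e3 * p))"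
    show ?thesis
    proof (rule that[of ?\<pi>])
      fix p assume a: "\<And>u. L (u * p) = 0"
      from a[of 1] a[of e1] a[of e2] a[of e3] show "?\<pi> p = 0" by (simp add: quat_eq_iff)
    next
      fix p q
      show "?\<pi> (p * q) = ?\<pi> p * ?\<pi> q"
        using e[of p q] e[of "e1 * p" q] e[of "e2 * p" q] e[of "e3 * p" q]
        by (simp add: quat_eq_iff mult.assoc tab tab')
    qed (simp_all add: quat_eq_iff unit add scale star zero distrib_left skew_star quaternion s3)
  qed
qed

end

text \<open>The representation respects the involution, so it is evaluation at the images of the
  letters q_i. The value of a constraint is a self-conjugate quaternion, that is, the real number
  \<open>L g\<close>; elements of \<open>H\<close> are null and therefore map to 0.\<close>

lemma quaternionic_point:
  assumes "tracial_character R G H L"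
  obtains a where "\<And>p. L p = qRe (falg_eval p a)"
    "\<And>g. g \<in> G \<Longrightarrow> falg_eval g a \<in> \<real>\<^sub>\<ge>\<^sub>0" "\<And>h. h \<in> H \<Longrightarrow> falg_eval h a = 0"
proof -
  interpret tracial_character R G H L by fact
  obtain \<pi> where \<pi>: "\<And>p. qRe (\<pi> p) = L p" "\<pi> 1 = 1" "\<And>p q. \<pi> (p + q) = \<pi> p + \<pi> q"
    "\<And>r p. \<pi> (falg_scale r p) = r *\<^sub>R \<pi> p" "\<And>p q. \<pi> (p * q) = \<pi> p * \<pi> q"
    "\<And>p. \<pi> (falg_star p) = qcnj (\<pi> p)" "\<And>p. (\<And>u. L (u * p) = 0) \<Longrightarrow> \<pi> p = 0"
    using quaternion_representation by blast
  define a where "a = (\<chi> i. \<pi> (mon (letter_word (Q i))))"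
  have letter: "\<pi> (mon (letter_word x)) = letter_eval a x" for x
    using \<pi>(6)[of "mon (letter_word (Q (idx x)))"] by (cases x) (simp_all add: a_def)
  have word: "\<pi> (mon w) = word_eval a w" for w
  proof (induct w)
    case zero
    show ?case using \<pi>(2) by simp
  next
    case (add x w)
    have "mon (letter_word x + w) = mon (letter_word x) * mon w" by (simp add: mult_single)
    then show ?case by (simp add: \<pi>(5) letter add word_eval_add)
  qed
  have eval: "\<pi> p = falg_eval p a" for p
  proof (induction p rule: poly_mapping_add_single_induct)
    case zero
    show ?case using \<pi>(7)[of 0] by simp
  next
    case (add p w r)
    have "\<pi> (Poly_Mapping.single w r) = falg_eval (Poly_Mapping.single w r) a"
      using \<pi>(4)[of r "mon w"] word[of w] by (simp add: falg_scale_def mult_single)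
    with add show ?case by (simp add: \<pi>(3) falg_eval_add)
  qed
  show ?thesis
  proof
    show "L p = qRe (falg_eval p a)" for p using \<pi>(1) eval by simp
    show "falg_eval h a = 0" if "h \<in> H" for h
      using \<pi>(7)[of h] ideal[OF that] eval by simp
    show "falg_eval g a \<in> \<real>\<^sub>\<ge>\<^sub>0" if g: "g \<in> G" for g
    proof -
      have "falg_star g = g" using g G_Sym by (auto simp: Sym_iff)
      with \<pi>(6)[of g] have "qcnj (falg_eval g a) = falg_eval g a" by (simp add: eval)
      then have "falg_eval g a = of_real (L g)"
        using \<pi>(1)[of g] by (simp add: eval quat_eq_iff of_real_def)
      moreover have "0 \<le> L g" using nonneg[of g 1] g by simp
      ultimately show ?thesis by simp
    qed
  qed
qed


section \<open>Extreme states\<close>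

text \<open>Minimizing the functionals \<open>f 0, f 1, \<dots>\<close> one after the other gives an extreme point in which
  \<open>f 0\<close> is minimal, without an appeal to the Krein-Milman theorem.\<close>

lemma lexicographic_minimum:
  fixes S :: "'a::topological_space set" and f :: "nat \<Rightarrow> 'a \<Rightarrow> real"
  assumes S: "compact S" "closed S" "S \<noteq> {}" and f: "\<And>k. continuous_on UNIV (f k)"
  obtains y where "y \<in> S" "\<And>z. z \<in> S \<Longrightarrow> f 0 y \<le> f 0 z"
    "\<And>A B t k. A \<in> S \<Longrightarrow> B \<in> S \<Longrightarrow> 0 < t \<Longrightarrow> t < 1 \<Longrightarrow>
      (\<And>k. f k y = t * f k A + (1 - t) * f k B) \<Longrightarrow> f k A = f k y"
proof -
  \<comment> \<open>\<open>F k\<close> is what remains of \<open>S\<close> after the first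
    \<open>k\<close> functions have been minimized in turn.\<close>
  define F where "F = rec_nat S (\<lambda>k T. {y \<in> T. \<forall>z\<in>T. f k y \<le> f k z})"
  have F0: "F 0 = S" and FS: "F (Suc k) = {y \<in> F k. \<forall>z\<in>F k. f k y \<le> f k z}" for k
    by (simp_all add: F_def)
  have sub: "F k \<subseteq> S" for k by (induction k) (auto simp: F0 FS)
  have F: "closed (F k) \<and> F k \<noteq> {}" for k
  proof (induction k)
    case 0
    then show ?case using S by (simp add: F0)
  next
    case (Suc k)
    have "F (Suc k) = F k \<inter> (\<Inter>z\<in>F k. {y. f k y \<le> f k z})" by (auto simp: FS)
    moreover have "closed {y. f k y \<le> f k z}" for z
      by (intro closed_Collect_le f continuous_on_const)
    ultimately have "closed (F (Suc k))" using Suc by (simp only:) (intro closed_Int closed_INT ballI; simp)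
    moreover have "compact (F k)"
      using compact_Int_closed[OF S(1), of "F k"] Suc sub[of k] by (simp add: inf.absorb2)
    then obtain y where "y \<in> F k" "\<forall>z\<in>F k. f k y \<le> f k z"
      using continuous_attains_inf[of "F k" "f k"] Suc continuous_on_subset[OF f] by blast
    ultimately show ?case by (auto simp: FS)
  qed
  have decr: "F (Suc k) \<subseteq> F k" for k by (auto simp: FS)
  have "S \<inter> (\<Inter>k. F k) \<noteq> {}"
  proof (rule compact_imp_fip_image[OF S(1)])
    fix I :: "nat set" assume "finite I"
    have "F (Max (insert 0 I)) \<subseteq> F i" if "i \<in> I" for i
      using \<open>finite I\<close> that by (intro lift_Suc_antimono_le[of F, OF decr]) auto
    then show "S \<inter> (\<Inter>k\<in>I. F k) \<noteq> {}" using F sub by fast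
  qed (use F in auto)
  then obtain y where y: "y \<in> S" "\<And>k. y \<in> F k" by blast
  show ?thesis
  proof (rule that[of y])
    show "f 0 y \<le> f 0 z" if "z \<in> S" for z
      using y(2)[of 1] that by (simp add: FS F0)
    fix A B t k
    assume AB: "A \<in> S" "B \<in> S" and t: "0 < t" "t < 1"
      and eq: "\<And>k. f k y = t * f k A + (1 - t) * f k B"
    have "A \<in> F k \<and> B \<in> F k \<and> (\<forall>j<k. f j A = f j y)" for k
    proof (induction k)
      case 0
      then show ?case using AB by (simp add: F0)
    next
      case (Suc k)
      have le: "f k y \<le> f k A" "f k y \<le> f k B"
        using y(2)[of "Suc k"] Suc by (auto simp: FS)
      \<comment> \<open>A proper convex combination of two values above the minimum equals the
        minimum only if both do, so \<open>A\<close> and \<open>B\<close> stay in the next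
        set.\<close>
      have "t * (f k A - f k y) + (1 - t) * (f k B - f k y) = 0"
        using eq[of k] by (simp add: algebra_simps)
      moreover have "0 \<le> t * (f k A - f k y)" "0 \<le> (1 - t) * (f k B - f k y)"
        using le t by simp_all
      ultimately have "t * (f k A - f k y) = 0" "(1 - t) * (f k B - f k y) = 0"
        by linarith+
      then have "f k A = f k y" "f k B = f k y" using t by auto
      with Suc y(2)[of "Suc k"] show ?case by (auto simp: FS less_Suc_eq)
    qed
    from this[of "Suc k"] show "f k A = f k y" by simp
  qed (rule y(1))
qed

section \<open>The compact set of states and its extreme points\<close>

lemma riesz_falg_scale: "riesz y (falg_scale r p) = r * riesz y p"
  by (simp add: falg_scale_def riesz_const_mult)

lemma continuous_on_riesz: "continuous_on UNIV (\<lambda>y. riesz y p)"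
  unfolding riesz_def by (intro continuous_intros) auto

text \<open>Leads back from functionals to sequences: weighting produces functionals, but states are
  sequences.\<close>

lemma (in tracial_positive) eq_riesz: "L p = riesz (\<lambda>w. L (mon w)) p"
proof (induction p rule: poly_mapping_add_single_induct)
  case (add p w r)
  have "Poly_Mapping.single w r = falg_scale r (mon w)" by (simp add: falg_scale_def mult_single)
  then have "L (Poly_Mapping.single w r) = r * L (mon w)" by (simp only: scale)
  with add central_trace.add[OF central_trace_axioms, of p "Poly_Mapping.single w r"]
  show ?case by (simp add: riesz_add)
qed simp

lemma (in tracial_positive) positive_multiple:
  assumes "0 \<le> r"
  shows "tracial_positive R G H (\<lambda>p. r * L p)"
proof
  show "r * L (p * q) = r * L (q * p)" for p q using trace[of p q] by simp
  show "r * L (p * (c * x)) = r * L (p * (x * c))" if "c \<in> Sym" for c p x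
    using central[OF that] by simp
qed (use assms R_nonneg G_Sym gap_in_G in \<open>simp_all add: add scale star ideal distrib_left nonneg\<close>)

text \<open>States are kept as points of a product of real lines, where compactness is Tychonoff's
  theorem. The normalization reads \<open>y 0\<close> because the empty word is
  \<open>0\<close>.\<close>

definition states :: "real \<Rightarrow> 'n::finite falg set \<Rightarrow> 'n falg set \<Rightarrow> ('n qword \<Rightarrow> real) set" where
  "states R G H = {y. tracial_positive R G H (riesz y) \<and> y 0 = 1}"

lemma closed_states: "closed (states R G H)"
  unfolding states_def tracial_positive_def tracial_positive_axioms_def central_trace_def
  by (intro closed_Collect_conj closed_Collect_all closed_Collect_imp closed_Collect_eq
      closed_Collect_le open_Collect_const closed_Collect_const continuous_intros continuous_on_riesz
      continuous_on_product_coordinates)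

text \<open>Cauchy-Schwarz against 1 bounds each coordinate by the square root of a constant from
  \<open>mult_bounded\<close>, so the states form a closed subset of a product of compact
  intervals.\<close>

lemma compact_states: "compact (states R G H :: ('n::finite qword \<Rightarrow> real) set)"
proof -
  have "\<exists>B. \<forall>y\<in>states R G H. \<bar>y w\<bar> \<le> B" for w :: "'n qword"
  proof -
    obtain C where C: "\<And>L p. tracial_positive R G H L \<Longrightarrow>
        L (falg_star (mon w * p) * (mon w * p)) \<le> C * L (falg_star p * p)"
      using mult_bounded[of R G H "mon w"] by blast
    have "\<bar>y w\<bar> \<le> sqrt C" if y: "y \<in> states R G H" for y
    proof -
      interpret tracial_positive R G H "riesz y" using y by (simp add: states_def)
      have one: "riesz y 1 = 1" using y by (simp add: states_def flip: single_one)
      have "(y w)\<^sup>2 \<le> riesz y (falg_star (mon w) * mon w)"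
        using Cauchy_Schwarz[of 1 1 "mon w"] one by simp
      also have "\<dots> \<le> C" using C[OF tracial_positive_axioms, of 1] one by simp
      finally show ?thesis using real_le_rsqrt[of "\<bar>y w\<bar>" C] by simp
    qed
    then show ?thesis by blast
  qed
  then obtain B where B: "\<And>w y. y \<in> states R G H \<Longrightarrow> \<bar>y w\<bar> \<le> B w" by metis
  have "compactin (product_topology (\<lambda>_. euclidean) UNIV) (PiE UNIV (\<lambda>w. {- B w..B w}))"
    by (simp add: compactin_PiE)
  then have "compact (PiE UNIV (\<lambda>w. {- B w..B w}))"
    by (simp add: euclidean_product_topology)
  then have "compact (PiE UNIV (\<lambda>w. {- B w..B w}) \<inter> states R G H)"
    by (rule compact_Int_closed) (rule closed_states)
  moreover have "states R G H \<subseteq> PiE UNIV (\<lambda>w. {- B w..B w})"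
  proof
    fix y assume "y \<in> states R G H"
    from B[OF this] show "y \<in> PiE UNIV (\<lambda>w. {- B w..B w})" by (auto simp: abs_le_iff minus_le_iff)
  qed
  ultimately show ?thesis by (simp add: inf.absorb2)
qed

lemma extreme_state_multiplicative:
  assumes y: "y \<in> states R G H"
    and extreme: "\<And>A B t. A \<in> states R G H \<Longrightarrow> B \<in> states R G H \<Longrightarrow> 0 < t \<Longrightarrow> t < 1 \<Longrightarrow>
      (\<And>w. y w = t * A w + (1 - t) * B w) \<Longrightarrow> A = y"
  shows "tracial_character R G H (riesz y)"
proof -
  interpret tracial_positive R G H "riesz y" using y by (simp add: states_def)
  define L where "L = riesz y"
  have one: "L 1 = 1" using y by (simp add: L_def states_def flip: single_one)
  have square: "L (c * c * p) = L (c * c) * L p" if c: "c \<in> Sym" for c p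
  proof -
    have cs: "falg_star c = c" using c by (simp add: Sym_iff)
    obtain C where C: "C > 0" "\<And>g p. g \<in> insert 1 G \<Longrightarrow>
        L (falg_star p * (g * (c * (c * p)))) \<le> C * L (falg_star p * (g * p))"
      using square_mult_bounded[OF c, of R G H] tracial_positive_axioms unfolding L_def by blast
    define m where "m = L (c * c)"
    \<comment> \<open>With \<open>C + 1\<close> in place of \<open>C\<close> the complementary mass
      \<open>C + 1 - m\<close> is positive, so this part can be normalized too.\<close>
    define d where "d = const (C + 1) - c * c"
    have m: "0 \<le> m" "m \<le> C"
      using square_nonneg[of c] C(2)[of 1 1] by (simp_all add: m_def L_def[symmetric] cs one)
    interpret P: tracial_positive R G H "\<lambda>p. L (c * c * p)"
      unfolding L_def
    proof (rule weighted)
      show "c * c \<in> Sym" by (simp add: Sym_iff cs)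
      show "0 \<le> riesz y (falg_star p * (g * (c * c * p)))" if "g \<in> insert 1 G" for g p
        using nonneg[OF that, of "c * p"] central_mid[OF c, of "falg_star p" g "c * p"]
        by (simp add: cs mult.assoc)
    qed
    have d: "L (d * p) = (C + 1) * L p - L (c * c * p)" for p
      unfolding d_def const_eq_scale[of "C + 1"]
      by (simp only: left_diff_distrib L_def diff falg_scale_simps scale mult_1)
    interpret N: tracial_positive R G H "\<lambda>p. L (d * p)"
      unfolding L_def
    proof (rule weighted)
      show "d \<in> Sym" by (simp add: d_def Sym_iff cs)
      fix g p :: "'a falg" assume g: "g \<in> insert 1 G"
      have "L (falg_star p * (g * (d * p)))
        = (C + 1) * L (falg_star p * (g * p)) - L (falg_star p * (g * (c * (c * p))))"
        unfolding d_def const_eq_scale[of "C + 1"]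
        by (simp only: left_diff_distrib right_diff_distrib L_def diff falg_scale_simps scale mult_1 mult.assoc)
      then show "0 \<le> riesz y (falg_star p * (g * (d * p)))"
        using C(2)[OF g, of p] nonneg[OF g, of p] by (simp add: L_def algebra_simps)
    qed
    show ?thesis
    proof (cases "m = 0")
      case True
      then show ?thesis using P.eq_zero_if_mass_zero[of p] by (simp add: m_def)
    next
      case False
      then have m0: "0 < m" using m by simp
      define A where "A w = 1 / m * L (c * c * mon w)" for w
      define B where "B w = 1 / (C + 1 - m) * L (d * mon w)" for w
      have PA: "1 / m * L (c * c * p) = riesz A p" for p
        unfolding A_def using m0
        by (intro tracial_positive.eq_riesz[OF P.positive_multiple]) simp
      have NB: "1 / (C + 1 - m) * L (d * p) = riesz B p" for p
        unfolding B_def using m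
        by (intro tracial_positive.eq_riesz[OF N.positive_multiple]) simp
      have "A \<in> states R G H"
        using P.positive_multiple[of "1 / m"] m0 unfolding PA states_def
        by (simp add: A_def m_def)
      moreover have "B \<in> states R G H"
        using N.positive_multiple[of "1 / (C + 1 - m)"] m unfolding NB states_def
        by (simp add: B_def d[of 1, simplified] one m_def[symmetric])
      moreover have "y w = m / (C + 1) * A w + (1 - m / (C + 1)) * B w" for w
      proof -
        have "m / (C + 1) * A w = L (c * c * mon w) / (C + 1)" using m0 by (simp add: A_def)
        moreover have "(1 - m / (C + 1)) * B w = L (d * mon w) / (C + 1)"
        proof -
          have "1 - m / (C + 1) = (C + 1 - m) / (C + 1)" using C(1) by (simp add: diff_divide_distrib)
          then show ?thesis using m by (simp add: B_def)
        qed
        moreover have "L (d * mon w) = (C + 1) * y w - L (c * c * mon w)"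
          using d[of "mon w"] by (simp add: L_def)
        ultimately show ?thesis using C(1) by (simp add: diff_divide_distrib)
      qed
      moreover have "0 < m / (C + 1)" "m / (C + 1) < 1" using m m0 C(1) by simp_all
      ultimately have "A = y" by (intro extreme)
      then show ?thesis using PA[of p] m0 by (simp add: L_def m_def field_simps)
    qed
  qed
  \<comment> \<open>Polarization: 4 c is the difference of the squares of c + 1 and c - 1.\<close>
  have "L (c * p) = L c * L p" if c: "c \<in> Sym" for c p
  proof -
    have s: "c + 1 \<in> Sym" "c - 1 \<in> Sym" using c by (simp_all add: Sym_iff)
    have e: "L ((c + 1) * (c + 1) * p) - L ((c - 1) * (c - 1) * p) = 4 * L (c * p)" for p
      by (simp add: L_def distrib_left distrib_right left_diff_distrib right_diff_distrib add diff)
    have "4 * L (c * p) = (L ((c + 1) * (c + 1)) - L ((c - 1) * (c - 1))) * L p"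
      using e[of p] square[OF s(1), of p] square[OF s(2), of p] by (simp add: left_diff_distrib)
    also have "\<dots> = 4 * L c * L p" using e[of 1] by simp
    finally show ?thesis by simp
  qed
  with one show ?thesis unfolding L_def by unfold_locales
qed

lemma states_evaluation_lower_bound:
  fixes y :: "'n::finite qword \<Rightarrow> real"
  assumes "y \<in> states R G H"
  obtains a where "\<And>g. g \<in> G \<Longrightarrow> falg_eval g a \<in> \<real>\<^sub>\<ge>\<^sub>0" "\<And>h. h \<in> H \<Longrightarrow> falg_eval h a = 0"
    "qRe (falg_eval p a) \<le> riesz y p"
proof -
  obtain w :: "nat \<Rightarrow> 'n qword" where w: "range w = UNIV"
    using countable_qword by (metis UNIV_not_empty uncountable_def)
  \<comment> \<open>The function to be minimized comes first; the coordinates after it separate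
    points, which turns the lexicographic minimizer into an extreme point.\<close>
  define f where "f k y = (case k of 0 \<Rightarrow> riesz y p | Suc i \<Rightarrow> y (w i))" for k and y :: "'n qword \<Rightarrow> real"
  have "continuous_on UNIV (f k)" for k
    unfolding f_def by (cases k) (simp_all add: continuous_on_riesz)
  then obtain z where z: "z \<in> states R G H" "\<And>z'. z' \<in> states R G H \<Longrightarrow> f 0 z \<le> f 0 z'"
    "\<And>A B t k. A \<in> states R G H \<Longrightarrow> B \<in> states R G H \<Longrightarrow> 0 < t \<Longrightarrow> t < 1 \<Longrightarrow>
      (\<And>k. f k z = t * f k A + (1 - t) * f k B) \<Longrightarrow> f k A = f k z"
    using lexicographic_minimum[OF compact_states closed_states, of R G H f] assms by blast
  have "tracial_character R G H (riesz z)"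
  proof (rule extreme_state_multiplicative[OF z(1)])
    fix A B t
    assume AB: "A \<in> states R G H" "B \<in> states R G H" "0 < t" "t < 1"
      and eq: "\<And>w. z w = t * A w + (1 - t) * B w"
    have "riesz z p = t * riesz A p + (1 - t) * riesz B p"
      unfolding riesz_def sum_distrib_left sum.distrib[symmetric]
      by (intro sum.cong) (simp_all add: eq algebra_simps)
    then have "f k z = t * f k A + (1 - t) * f k B" for k
      by (simp add: f_def eq split: nat.split)
    then have k: "f k A = f k z" for k by (rule z(3)[OF AB])
    show "A = z"
    proof
      fix u
      obtain i where "u = w i" using w by (metis rangeE UNIV_I)
      with k[of "Suc i"] show "A u = z u" by (simp add: f_def)
    qed
  qed
  then obtain a where a: "\<And>p. riesz z p = qRe (falg_eval p a)"
    "\<And>g. g \<in> G \<Longrightarrow> falg_eval g a \<in> \<real>\<^sub>\<ge>\<^sub>0" "\<And>h. h \<in> H \<Longrightarrow> falg_eval h a = 0"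
    using quaternionic_point by blast
  have "qRe (falg_eval p a) \<le> riesz y p"
    using z(2)[OF assms] a(1)[of p] by (simp add: f_def)
  with a show ?thesis by (intro that[of a])
qed


section \<open>Measures with prescribed moments on a compact set\<close>

lemma binary_expansion:
  fixes x :: real
  assumes "0 \<le> x" "x \<le> 1"
  obtains b :: "nat \<Rightarrow> bool" where "(\<lambda>k. of_bool (b k) * (1/2) ^ Suc k) sums x"
proof -
  \<comment> \<open>\<open>r k\<close> is the remainder after \<open>k\<close> digits, rescaled by
    2^k. The remainder 1 reproduces itself, so x = 1 gets the expansion with all digits 1.\<close>
  define r where "r = rec_nat x (\<lambda>_ s. 2 * s - of_bool (1/2 \<le> s))"
  define b where "b k \<longleftrightarrow> 1/2 \<le> r k" for k
  have r0: "r 0 = x" and rS: "r (Suc k) = 2 * r k - of_bool (b k)" for k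
    by (simp_all add: r_def b_def)
  have r: "0 \<le> r k \<and> r k \<le> 1" for k
    by (induction k) (use assms in \<open>auto simp: r0 rS b_def\<close>)
  have partial: "(\<Sum>i<k. of_bool (b i) * (1/2) ^ Suc i) = x - r k * (1/2) ^ k" for k
    by (induction k) (auto simp: r0 rS field_simps)
  have "(\<lambda>k. r k * (1/2) ^ k) \<longlonglongrightarrow> 0"
  proof (rule tendsto_sandwich[of "\<lambda>_. 0" _ _ "\<lambda>k. (1/2::real) ^ k"])
    show "\<forall>\<^sub>F k in sequentially. r k * (1/2) ^ k \<le> (1/2) ^ k"
      using r by (intro always_eventually allI mult_left_le_one_le) auto
  qed (use r in \<open>auto intro: LIMSEQ_realpow_zero\<close>)
  then have "(\<lambda>k. x - r k * (1/2) ^ k) \<longlonglongrightarrow> x - 0" by (intro tendsto_intros)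
  then show ?thesis by (intro that[of b]) (simp only: sums_def partial diff_zero)
qed

text \<open>On \<open>[0, 1/3]\<close> this function is \<open>0\<close> and on \<open>[2/3, 1]\<close> it is \<open>1\<close>, so it reads the ternary digit
  \<open>0\<close> or \<open>2\<close> of a point of the Cantor set; it has period \<open>2\<close>.\<close>

definition schoenberg :: "real \<Rightarrow> real" where
  "schoenberg t = max 0 (min 1 (1/2 - cos (pi * t)))"

lemma schoenberg_range: "0 \<le> schoenberg t" "schoenberg t \<le> 1"
  by (auto simp: schoenberg_def)

text \<open>\<open>t\<close> has the ternary digits 2 c(m). Multiplication by 3^m shifts
  \<open>m\<close> of them into the integer part, which is even because the digits are 0 or 2; by
  periodicity only the tail, led by the digit 2 c(m), matters.\<close>

lemma schoenberg_digits:
  obtains t where "0 \<le> t" "t \<le> 1" "\<And>m. schoenberg (3 ^ m * t) = of_bool (c m)"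
proof -
  let ?g = "\<lambda>m j. 2 * of_bool (c (m + j)) * (1/3::real) ^ Suc j"
  have geo: "(\<lambda>j. 2 * (1/3::real) ^ Suc j) sums 1"
    using sums_mult[OF geometric_sums[of "1/3::real"], of "2/3"] by simp
  have sg: "summable (?g m)" for m
    by (rule summable_comparison_test'[OF sums_summable[OF geo], of 0]) (auto simp: abs_mult)
  define T where "T m = suminf (\<lambda>j. ?g m j)" for m
  have T0: "0 \<le> T m" for m unfolding T_def by (intro suminf_nonneg sg) simp
  have "T m \<le> suminf (\<lambda>j. 2 * (1/3::real) ^ Suc j)" for m
    unfolding T_def by (intro suminf_le sg sums_summable[OF geo]) simp
  then have T1: "T m \<le> 1" for m unfolding sums_unique[OF geo, symmetric] .
  have step: "3 * T m = 2 * of_bool (c m) + T (Suc m)" for m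
  proof -
    have "suminf (\<lambda>j. ?g m (Suc j)) = T m - 2 * of_bool (c m) / 3"
      unfolding T_def using suminf_split_head[OF sg[of m]] by simp
    moreover have "suminf (\<lambda>j. ?g m (Suc j)) = T (Suc m) / 3"
      unfolding T_def suminf_divide[OF sg, symmetric] by (simp add: algebra_simps)
    ultimately show ?thesis by simp
  qed
  have "\<exists>N::nat. 3 ^ m * T 0 = 2 * real N + T m" for m
  proof (induction m)
    case (Suc m)
    then obtain N where "3 ^ m * T 0 = 2 * real N + T m" by blast
    then have "3 ^ Suc m * T 0 = 2 * real (3 * N + of_bool (c m)) + T (Suc m)"
      using step[of m] by simp
    then show ?case by blast
  qed (auto intro: exI[of _ 0])
  moreover have "schoenberg (2 * real N + T m) = of_bool (c m)" for m N
  proof -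
    have "cos (pi * (2 * real N + T m)) = cos (pi * T m)"
    proof -
      have "pi * (2 * real N + T m) = 2 * real N * pi + pi * T m" by (simp add: algebra_simps)
      then show ?thesis by (simp add: cos_add)
    qed
    moreover have "cos (pi * T m) \<le> -1/2" if "c m"
    proof -
      have "2/3 \<le> T m" using step[of m] T0[of "Suc m"] that by simp
      then have "pi * (2/3) \<le> pi * T m" by (intro mult_left_mono) auto
      then have "cos (pi * T m) \<le> cos (2 * pi / 3)"
        using T1[of m] by (intro cos_monotone_0_pi_le) (auto simp: mult_left_le)
      then show ?thesis by (simp add: cos_120)
    qed
    moreover have "1/2 \<le> cos (pi * T m)" if "\<not> c m"
    proof -
      have "T m \<le> 1/3" using step[of m] T1[of "Suc m"] that by simp
      then have "pi * T m \<le> pi * (1/3)" by (intro mult_left_mono) auto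
      then have "cos (pi / 3) \<le> cos (pi * T m)"
        using T0[of m] by (intro cos_monotone_0_pi_le) auto
      then show ?thesis by (simp add: cos_60)
    qed
    ultimately show ?thesis by (cases "c m") (auto simp: schoenberg_def)
  qed
  ultimately show ?thesis using T0[of 0] T1[of 0] by (intro that[of "T 0"]) metis+
qed

text \<open>Coordinate \<open>j\<close> of the curve takes its \<open>k\<close>-th binary digit from
  the ternary digit D k + j of the parameter. Continuity and boundedness on the whole line make
  pulled-back continuous functions admissible for weak convergence.\<close>

lemma space_filling_curve:
  fixes r :: real
  assumes "0 < r"
  obtains \<phi> :: "real \<Rightarrow> 'a::euclidean_space"
  where "continuous_on UNIV \<phi>" "bounded (range \<phi>)" "cbox (- (r *\<^sub>R One)) (r *\<^sub>R One) \<subseteq> \<phi> ` {0..1}"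
proof -
  define D where "D = DIM('a)"
  have D: "0 < D" by (simp add: D_def)
  obtain h :: "'a \<Rightarrow> nat" where h: "bij_betw h Basis {0..<D}"
    using ex_bij_betw_finite_nat[OF finite_Basis] unfolding D_def by blast
  define f where "f j k t = schoenberg (3 ^ (D * k + j) * t) * (1/2) ^ Suc k" for j k t
  define \<psi> where "\<psi> j t = suminf (\<lambda>k. f j k t)" for j t
  have geo: "(\<lambda>k. (1/2::real) ^ Suc k) sums 1"
    using sums_mult[OF geometric_sums[of "1/2::real"], of "1/2"] by simp
  have f: "norm (f j k t) \<le> (1/2) ^ Suc k" "0 \<le> f j k t" for j k t
    using schoenberg_range[of "3 ^ (D * k + j) * t"] by (simp_all add: f_def)
  have sf: "summable (\<lambda>k. f j k t)" for j t
    by (rule summable_comparison_test'[OF sums_summable[OF geo], of 0]) (rule f)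
  have \<psi>0: "0 \<le> \<psi> j t" for j t unfolding \<psi>_def by (intro suminf_nonneg sf f)
  have "\<psi> j t \<le> suminf (\<lambda>k. (1/2) ^ Suc k)" for j t
    unfolding \<psi>_def using f by (intro suminf_le sf sums_summable[OF geo]) (simp add: abs_le_iff)
  then have \<psi>1: "\<psi> j t \<le> 1" for j t using sums_unique[OF geo] by simp
  have c\<psi>: "continuous_on UNIV (\<psi> j)" for j
  proof (rule uniform_limit_theorem)
    show "uniform_limit UNIV (\<lambda>n t. \<Sum>k<n. f j k t) (\<psi> j) sequentially"
      unfolding \<psi>_def by (rule Weierstrass_m_test[OF f(1) sums_summable[OF geo]])
    show "\<forall>\<^sub>F n in sequentially. continuous_on UNIV (\<lambda>t. \<Sum>k<n. f j k t)"
      unfolding f_def schoenberg_def by (intro always_eventually allI continuous_intros)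
  qed simp
  define \<phi> where "\<phi> t = (\<Sum>b\<in>Basis. (r * (2 * \<psi> (h b) t - 1)) *\<^sub>R b :: 'a)" for t
  show ?thesis
  proof
    show "continuous_on UNIV \<phi>"
      unfolding \<phi>_def by (intro continuous_intros c\<psi>)
    have "norm (\<phi> t) \<le> (\<Sum>b\<in>(Basis::'a set). r)" for t
      unfolding \<phi>_def
    proof (rule sum_norm_le)
      fix b :: 'a assume "b \<in> Basis"
      then show "norm ((r * (2 * \<psi> (h b) t - 1)) *\<^sub>R b) \<le> r"
        using assms \<psi>0[of "h b" t] \<psi>1[of "h b" t] by (simp add: abs_mult abs_le_iff)
    qed
    then show "bounded (range \<phi>)" by (auto simp: bounded_iff)
    show "cbox (- (r *\<^sub>R One)) (r *\<^sub>R One) \<subseteq> \<phi> ` {0..1}"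
    proof
      fix x :: 'a assume x: "x \<in> cbox (- (r *\<^sub>R One)) (r *\<^sub>R One)"
      define u where "u b = (x \<bullet> b / r + 1) / 2" for b
      have "\<forall>b\<in>Basis. \<exists>B. (\<lambda>k. of_bool (B k) * (1/2) ^ Suc k) sums u b"
      proof
        fix b :: 'a assume that: "b \<in> Basis"
        have "- r \<le> x \<bullet> b" "x \<bullet> b \<le> r" using x that by (auto simp: mem_box)
        then have "0 \<le> u b" "u b \<le> 1" using assms by (auto simp: u_def field_simps)
        then show "\<exists>B. (\<lambda>k. of_bool (B k) * (1/2) ^ Suc k) sums u b"
          by (rule binary_expansion) blast
      qed
      from bchoice[OF this] obtain B
        where B: "\<forall>b\<in>Basis. (\<lambda>k. of_bool (B b k) * (1/2) ^ Suc k) sums u b" ..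
      \<comment> \<open>Position m = D k + j carries digit \<open>k\<close> of coordinate
        \<open>j\<close>: \<open>m mod D\<close> selects the basis vector and \<open>m div D\<close>
        the digit.\<close>
      obtain t where t: "0 \<le> t" "t \<le> 1"
        "\<And>m. schoenberg (3 ^ m * t) = of_bool (B (inv_into Basis h (m mod D)) (m div D))"
        by (rule schoenberg_digits[of "\<lambda>m. B (inv_into Basis h (m mod D)) (m div D)"]) (rule that)
      have "\<psi> (h b) t = u b" if b: "b \<in> Basis" for b
      proof -
        have "h b < D" using h b by (auto simp: bij_betw_def)
        moreover have "inv_into Basis h (h b) = b" using h b by (simp add: bij_betw_def)
        ultimately have "f (h b) k t = of_bool (B b k) * (1/2) ^ Suc k" for k
          by (simp add: f_def t(3))
        then show ?thesis using sums_unique[OF B[rule_format, OF b]] by (simp only: \<psi>_def)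
      qed
      moreover have "\<phi> t \<bullet> b = r * (2 * \<psi> (h b) t - 1)" if "b \<in> Basis" for b
        unfolding \<phi>_def using that by (rule inner_sum_left_Basis)
      moreover have "r * (2 * u b - 1) = x \<bullet> b" for b
        using assms unfolding u_def by (simp add: field_simps)
      ultimately have e: "\<phi> t \<bullet> b = x \<bullet> b" if "b \<in> Basis" for b using that by (simp only:)
      have "x = \<phi> t" by (rule euclidean_eqI) (rule e[symmetric])
      moreover have "t \<in> {0..1}" using t(1,2) by (simp only: atLeastAtMost_iff)
      ultimately show "x \<in> \<phi> ` {0..1}" by (rule image_eqI)
    qed
  qed
qed

text \<open>Choosing each new point against the current residual keeps the residual of the sum of \<open>n\<close>
  vectors of order \<open>\<surd>n\<close>.\<close>

lemma greedy_averages: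
  fixes F :: "'i \<Rightarrow> 'a \<Rightarrow> real" and y B :: "'i \<Rightarrow> real"
  assumes bound: "\<And>i a. i \<in> I \<Longrightarrow> a \<in> A \<Longrightarrow> \<bar>F i a - y i\<bar> \<le> B i"
    and supp: "\<And>d. \<exists>a\<in>A. (\<Sum>i\<in>I. d i * F i a) \<le> (\<Sum>i\<in>I. d i * y i)"
  obtains a :: "nat \<Rightarrow> 'a" where "range a \<subseteq> A"
    "\<And>n. (\<Sum>i\<in>I. ((\<Sum>j<n. F i (a j)) - n * y i)\<^sup>2) \<le> n * (\<Sum>i\<in>I. (B i)\<^sup>2)"
proof -
  obtain pick where pick: "\<And>d. pick d \<in> A"
    "\<And>d. (\<Sum>i\<in>I. d i * F i (pick d)) \<le> (\<Sum>i\<in>I. d i * y i)"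
    using supp by metis
  define D where "D = rec_nat (\<lambda>_. 0) (\<lambda>_ d i. d i + (F i (pick d) - y i))"
  have D: "D 0 = (\<lambda>_. 0)" "D (Suc n) = (\<lambda>i. D n i + (F i (pick (D n)) - y i))" for n
    by (simp_all add: D_def)
  define a where "a n = pick (D n)" for n
  have eq: "(\<Sum>j<n. F i (a j)) - n * y i = D n i" for n i
    by (induction n) (simp_all add: D a_def algebra_simps)
  have "(\<Sum>i\<in>I. (D n i)\<^sup>2) \<le> n * (\<Sum>i\<in>I. (B i)\<^sup>2)" for n
  proof (induction n)
    case (Suc n)
    have "(\<Sum>i\<in>I. (D (Suc n) i)\<^sup>2) = (\<Sum>i\<in>I. (D n i)\<^sup>2)
        + 2 * ((\<Sum>i\<in>I. D n i * F i (a n)) - (\<Sum>i\<in>I. D n i * y i)) + (\<Sum>i\<in>I. (F i (a n) - y i)\<^sup>2)"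
      by (simp add: D a_def power2_eq_square algebra_simps sum.distrib sum_subtractf sum_distrib_left)
    \<comment> \<open>The choice of the new point makes the cross term nonpositive, so the squared
      residual grows by at most a constant per step.\<close>
    moreover have "(\<Sum>i\<in>I. D n i * F i (a n)) \<le> (\<Sum>i\<in>I. D n i * y i)"
      unfolding a_def by (rule pick(2))
    moreover have "(\<Sum>i\<in>I. (F i (a n) - y i)\<^sup>2) \<le> (\<Sum>i\<in>I. (B i)\<^sup>2)"
      using bound pick(1) by (intro sum_mono) (metis a_def abs_ge_zero power2_abs power_mono)
    ultimately show ?case using Suc by (simp add: algebra_simps)
  qed (simp add: D)
  moreover have "a n \<in> A" for n by (simp add: a_def pick(1))
  ultimately show ?thesis by (intro that[of a]) (auto simp: eq)
qed

text \<open>The approximating averages of point masses are pulled back along a space-filling curve, so that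
  Helly's selection theorem on the real line yields the weak limit.\<close>

lemma moment_measure_exists:
  fixes K :: "'a::euclidean_space set" and F :: "nat \<Rightarrow> 'a \<Rightarrow> real" and y :: "nat \<Rightarrow> real"
  assumes K: "compact K" and F: "\<And>i. continuous_on UNIV (F i)"
    and supp: "\<And>N d. \<exists>a\<in>K. (\<Sum>i<N. d i * F i a) \<le> (\<Sum>i<N. d i * y i)"
  obtains \<mu> where "prob_space \<mu>" "sets \<mu> = sets borel" "AE a in \<mu>. a \<in> K"
    "\<And>i. integrable \<mu> (F i)" "\<And>i. integral\<^sup>L \<mu> (F i) = y i"
proof -
  \<comment> \<open>\<open>infdist\<close> to the empty set is 0 by convention, so zero distance
    will characterize membership only for nonempty \<open>K\<close>.\<close>
  have "K \<noteq> {}" using supp[of _ 0] by auto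
  obtain r where r: "0 < r" "K \<subseteq> cbox (- (r *\<^sub>R One)) (r *\<^sub>R One)"
  proof -
    obtain b where b: "\<And>x. x \<in> K \<Longrightarrow> norm x \<le> b"
      using compact_imp_bounded[OF K] by (auto simp: bounded_iff)
    have "x \<in> cbox (- ((\<bar>b\<bar> + 1) *\<^sub>R One)) ((\<bar>b\<bar> + 1) *\<^sub>R One)" if "x \<in> K" for x
      using b[OF that] Basis_le_norm[of _ x] by (force simp: mem_box abs_le_iff)
    then show ?thesis by (intro that[of "\<bar>b\<bar> + 1"]) auto
  qed
  obtain \<phi> :: "real \<Rightarrow> 'a" where \<phi>: "continuous_on UNIV \<phi>" "bounded (range \<phi>)"
    "cbox (- (r *\<^sub>R One)) (r *\<^sub>R One) \<subseteq> \<phi> ` {0..1}"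
    using space_filling_curve[OF r(1)] by blast
  have [measurable]: "\<phi> \<in> borel_measurable borel" using \<phi>(1) by (rule borel_measurable_continuous_onI)
  have [measurable]: "F i \<in> borel_measurable borel" for i using F by (rule borel_measurable_continuous_onI)
  have "\<exists>B. \<forall>t. \<bar>F i (\<phi> t)\<bar> \<le> B" for i
  proof -
    have "bounded (F i ` closure (range \<phi>))"
      using F[of i] \<phi>(2) by (intro compact_imp_bounded compact_continuous_image)
        (auto intro: continuous_on_subset)
    then obtain B where B: "\<forall>x\<in>F i ` closure (range \<phi>). norm x \<le> B"
      unfolding bounded_iff ..
    have "\<phi> t \<in> closure (range \<phi>)" for t by (rule subsetD[OF closure_subset rangeI])
    then have "norm (F i (\<phi> t)) \<le> B" for t using B by blast
    then show ?thesis unfolding real_norm_def by blast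
  qed
  then obtain B where B: "\<And>i t. \<bar>F i (\<phi> t)\<bar> \<le> B i" by metis
  have K\<phi>: "\<exists>t\<in>{0..1}. a = \<phi> t" if "a \<in> K" for a using that r(2) \<phi>(3) by blast
  have "\<exists>n t. 0 < n \<and> (\<forall>j. t j \<in> {0..1} \<and> \<phi> (t j) \<in> K) \<and>
      (\<forall>i<N. \<bar>(\<Sum>j<n. F i (\<phi> (t j))) / real n - y i\<bar> \<le> 1 / Suc N)" for N
  proof -
    define C where "C i = B i + \<bar>y i\<bar>" for i
    have "\<bar>F i a - y i\<bar> \<le> C i" if aK: "a \<in> K" for i a
    proof -
      obtain t where "a = \<phi> t" using K\<phi>[OF aK] by blast
      then have "\<bar>F i a\<bar> \<le> B i" using B by simp
      then show ?thesis unfolding C_def by linarith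
    qed
    then obtain a :: "nat \<Rightarrow> 'a" where a: "range a \<subseteq> K"
      "\<And>n. (\<Sum>i<N. ((\<Sum>j<n. F i (a j)) - n * y i)\<^sup>2) \<le> n * (\<Sum>i<N. (C i)\<^sup>2)"
      using greedy_averages[of "{..<N}" K F y C, OF _ supp] by blast
    have "\<forall>j. \<exists>t\<in>{0..1}. a j = \<phi> t" using a(1) K\<phi> by blast
    then obtain t where t: "\<And>j. t j \<in> {0..1}" "\<And>j. \<phi> (t j) = a j" by metis
    define S where "S = (\<Sum>i<N. (C i)\<^sup>2)"
    \<comment> \<open>The squared residual is at most n S, so each average errs by at most sqrt (S /
      n), which this choice puts below 1 / (N + 1).\<close>
    obtain n :: nat where n: "S * (real (Suc N))\<^sup>2 < n" using reals_Archimedean2 by blast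
    have "0 \<le> S" unfolding S_def by (intro sum_nonneg) simp
    then have n0: "0 < n" using n by (metis less_le_trans not_gr0 of_nat_0 mult_nonneg_nonneg not_less zero_le_power2)
    have "\<bar>(\<Sum>j<n. F i (\<phi> (t j))) / real n - y i\<bar> \<le> 1 / Suc N" if "i < N" for i
    proof -
      define e where "e = (\<Sum>j<n. F i (a j)) - n * y i"
      have "e\<^sup>2 \<le> (\<Sum>i<N. ((\<Sum>j<n. F i (a j)) - n * y i)\<^sup>2)"
        using that unfolding e_def
        by (intro member_le_sum[of i "{..<N}" "\<lambda>i. ((\<Sum>j<n. F i (a j)) - n * y i)\<^sup>2"]) auto
      also have "\<dots> \<le> n * S" unfolding S_def by (rule a(2))
      finally have e: "e\<^sup>2 \<le> n * S" .
      have "(e * Suc N)\<^sup>2 = e\<^sup>2 * (real (Suc N))\<^sup>2" by (rule power_mult_distrib)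
      also have "\<dots> \<le> n * S * (real (Suc N))\<^sup>2" by (rule mult_right_mono[OF e]) simp
      also have "\<dots> = n * (S * (real (Suc N))\<^sup>2)" by (rule mult.assoc)
      also have "\<dots> \<le> real n * n" using n by (intro mult_left_mono) auto
      also have "\<dots> = (real n)\<^sup>2" by (rule power2_eq_square[symmetric])
      finally have "\<bar>e\<bar> * real (Suc N) \<le> real n"
        by (simp only: abs_le_square_iff[symmetric] abs_mult abs_of_nat)
      then have "\<bar>e / n\<bar> \<le> 1 / Suc N" using n0 by (simp add: field_simps)
      moreover have "(\<Sum>j<n. F i (\<phi> (t j))) / real n - y i = e / n"
        using n0 unfolding t(2) e_def diff_divide_distrib by simp
      ultimately show ?thesis by (simp only:)
    qed
    then show ?thesis using n0 t a(1) by (intro exI[of _ n] exI[of _ t]) auto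
  qed
  then obtain n t where n: "\<And>N. 0 < n N" and t: "\<And>N j. t N j \<in> {0..1}" "\<And>N j. \<phi> (t N j) \<in> K"
    and approx: "\<And>N i. i < N \<Longrightarrow> \<bar>(\<Sum>j<n N. F i (\<phi> (t N j))) / real (n N) - y i\<bar> \<le> 1 / Suc N"
    by metis
  \<comment> \<open>The empirical distribution of the first \<open>n N\<close> parameters, a measure
    on the line.\<close>
  define \<nu> where "\<nu> N = distr (measure_pmf (pmf_of_set {..<n N})) borel (t N)" for N
  have rd: "real_distribution (\<nu> N)" for N
    unfolding \<nu>_def by (intro prob_space.real_distribution_distr measure_pmf.prob_space_axioms) simp
  have int: "integral\<^sup>L (\<nu> N) f = (\<Sum>j<n N. f (t N j)) / n N"
    if "f \<in> borel_measurable borel" for f :: "real \<Rightarrow> real" and N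
  proof -
    have "{..<n N} \<noteq> {}" using n[of N] by auto
    then show ?thesis
      unfolding \<nu>_def using that by (subst integral_distr) (simp_all add: integral_pmf_of_set)
  qed
  \<comment> \<open>\<open>tight\<close> asks for half-open intervals, and the parameter 0 has to
    lie inside.\<close>
  have "measure (\<nu> N) {-1<..1} = 1" for N
  proof -
    have "-1 < t N j \<and> t N j \<le> 1" for j using t(1)[of N j] by simp
    then have "t N -` {-1<..1} = UNIV" by (simp add: set_eq_iff)
    then show ?thesis unfolding \<nu>_def
      by (subst measure_distr) (simp_all add: measure_pmf.prob_space[simplified])
  qed
  then have "tight \<nu>"
    unfolding tight_def using rd by (intro conjI allI impI exI[of _ "-1"] exI[of _ 1]) auto
  then obtain s M where s: "strict_mono s" and M: "real_distribution M" and w: "weak_conv_m (\<nu> \<circ> s) M"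
    using tight_imp_convergent_subsubsequence[of \<nu> id] strict_mono_id by (auto simp: id_def comp_def)
  interpret M: real_distribution M by (fact M)
  have conv: "(\<lambda>N. integral\<^sup>L (\<nu> (s N)) f) \<longlonglongrightarrow> integral\<^sup>L M f"
    if "continuous_on UNIV f" "\<And>x. \<bar>f x\<bar> \<le> C" for f :: "real \<Rightarrow> real" and C
    using weak_conv_imp_integral_bdd_continuous_conv[OF _ M w, of f C] rd that
    by (auto simp: continuous_on_eq_continuous_at)
  have F\<phi>: "continuous_on UNIV (\<lambda>x. F i (\<phi> x))" for i
    using continuous_on_compose2[OF F \<phi>(1)] by simp
  have moments: "integral\<^sup>L M (\<lambda>x. F i (\<phi> x)) = y i" for i
  proof (rule LIMSEQ_unique)
    show "(\<lambda>N. integral\<^sup>L (\<nu> (s N)) (\<lambda>x. F i (\<phi> x))) \<longlonglongrightarrow> integral\<^sup>L M (\<lambda>x. F i (\<phi> x))"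
      by (rule conv[OF F\<phi> B])
    have "(\<lambda>N. integral\<^sup>L (\<nu> N) (\<lambda>x. F i (\<phi> x)) - y i) \<longlonglongrightarrow> 0"
    proof (rule Lim_null_comparison)
      show "\<forall>\<^sub>F N in sequentially. norm (integral\<^sup>L (\<nu> N) (\<lambda>x. F i (\<phi> x)) - y i) \<le> 1 / real (Suc N)"
        using eventually_gt_at_top[of i] by eventually_elim (simp add: int approx del: of_nat_Suc)
      show "(\<lambda>N. 1 / real (Suc N)) \<longlonglongrightarrow> 0" using LIMSEQ_inverse_real_of_nat by (simp add: inverse_eq_divide)
    qed
    then have "(\<lambda>N. integral\<^sup>L (\<nu> N) (\<lambda>x. F i (\<phi> x))) \<longlonglongrightarrow> y i" by (simp add: LIM_zero_iff)
    from LIMSEQ_subseq_LIMSEQ[OF this s]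
    show "(\<lambda>N. integral\<^sup>L (\<nu> (s N)) (\<lambda>x. F i (\<phi> x))) \<longlonglongrightarrow> y i" by (simp add: comp_def)
  qed
  \<comment> \<open>A continuous function, bounded by the truncation, that vanishes exactly where
    the curve is in \<open>K\<close>. Its integral is 0 for every approximating measure and hence
    for the weak limit, which confines the limit to \<open>K\<close>.\<close>
  let ?d = "\<lambda>x. min 1 (infdist (\<phi> x) K)"
  have cd: "continuous_on UNIV ?d" by (intro continuous_intros \<phi>(1))
  have d: "\<bar>?d x\<bar> \<le> 1" "0 \<le> ?d x" for x by (auto simp: infdist_nonneg)
  have [measurable]: "?d \<in> borel_measurable borel" using cd by (rule borel_measurable_continuous_onI)
  have "integral\<^sup>L (\<nu> N) ?d = 0" for N by (simp add: int t(2))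
  with conv[OF cd d(1)] have "integral\<^sup>L M ?d = 0" by (simp add: LIMSEQ_const_iff)
  moreover have "integrable M ?d"
    using d by (intro M.integrable_const_bound[where B = 1]) auto
  ultimately have "AE x in M. ?d x = 0"
    by (subst (asm) integral_nonneg_eq_0_iff_AE) (auto simp: infdist_nonneg)
  then have AE: "AE x in M. \<phi> x \<in> K"
  proof eventually_elim
    case (elim x)
    then have "infdist (\<phi> x) K = 0" by (simp add: min_def split: if_splits)
    then show ?case using in_closed_iff_infdist_zero[OF compact_imp_closed[OF K] \<open>K \<noteq> {}\<close>] by blast
  qed
  show ?thesis
  proof
    show "prob_space (distr M borel \<phi>)" by (rule M.prob_space_distr) simp
    show "AE a in distr M borel \<phi>. a \<in> K"
      using AE K by (subst AE_distr_iff) (auto intro: borel_closed compact_imp_closed)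
    show "integrable (distr M borel \<phi>) (F i)" for i
      using B[of i] by (subst integrable_distr_eq) (auto intro!: M.integrable_const_bound[where B = "B i"])
    show "integral\<^sup>L (distr M borel \<phi>) (F i) = y i" for i
      using moments[of i] by (subst integral_distr) auto
  qed simp
qed


section \<open>Representing measures\<close>

text \<open>Splits membership into an equation and an inequality between continuous functions, from
  which closedness can be read off.\<close>

lemma nonneg_Reals_quat_iff: "x \<in> \<real>\<^sub>\<ge>\<^sub>0 \<longleftrightarrow> x = qRe x *\<^sub>R (1::quat) \<and> 0 \<le> qRe x"
  by (auto simp: nonneg_Reals_def of_real_def quat_eq_iff)

lemma continuous_on_qRe [continuous_intros]:
  "continuous_on S f \<Longrightarrow> continuous_on S (\<lambda>x. qRe (f x))"
proof -
  assume "continuous_on S f"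
  then have "continuous_on S (\<lambda>x. inner (f x) 1)" by (intro continuous_intros)
  then show ?thesis by (simp add: inner_quat_def)
qed

lemma continuous_on_qcnj [continuous_intros]:
  "continuous_on S f \<Longrightarrow> continuous_on S (\<lambda>x. qcnj (f x))"
proof -
  assume f: "continuous_on S f"
  have "qcnj x = (2 * qRe x) *\<^sub>R 1 - x" for x by (simp add: quat_eq_iff)
  with f show ?thesis by (simp only:) (intro continuous_intros)
qed

lemma continuous_on_word_eval: "continuous_on S (\<lambda>a. word_eval a w)"
proof (induct w)
  case (add x w)
  have "continuous_on S (\<lambda>a. letter_eval a x)"
    by (cases x) (auto intro!: continuous_intros)
  with add show ?case unfolding word_eval_add word_eval_letter by (intro continuous_on_mult)
qed simp

lemma continuous_on_falg_eval: "continuous_on S (falg_eval p)"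
  unfolding falg_eval_def by (intro continuous_intros continuous_on_word_eval)

section \<open>Necessity of the four conditions\<close>

lemma riesz_eq_integral:
  assumes "represents \<mu> y"
  shows "integrable \<mu> (\<lambda>a. qRe (falg_eval p a)) \<and> riesz y p = (\<integral>a. qRe (falg_eval p a) \<partial>\<mu>)"
proof (induction p rule: poly_mapping_add_single_induct)
  case (add p w r)
  have w: "integrable \<mu> (\<lambda>a. qRe (word_eval a w))" "y w = (\<integral>a. qRe (word_eval a w) \<partial>\<mu>)"
    using assms by (auto simp: represents_def)
  with add show ?case by (simp add: riesz_add falg_eval_add)
qed simp

text \<open>All four hold already under the integral, almost everywhere: conj(z) c z = c |z|^2, a
  factor h_j evaluates to 0, and w + w* evaluates to a real, hence central, quaternion.\<close>

lemma representing_measure_conditions: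
  assumes \<mu>: "represents \<mu> y" and K: "AE a in \<mu>. a \<in> semialg_set m g l h"
  shows "0 \<le> riesz y (falg_star p * p)"
    "i \<in> {1..m} \<Longrightarrow> 0 \<le> riesz y (falg_star p * g i * p)"
    "j \<in> {1..l} \<Longrightarrow> riesz y (p * h j * q) = 0"
    "riesz y (p * commutator (mon w + mon (word_star w)) x * q) = 0"
proof -
  have r: "riesz y p = (\<integral>a. qRe (falg_eval p a) \<partial>\<mu>)" for p
    using riesz_eq_integral[OF \<mu>] by blast
  have sq: "0 \<le> qRe (qcnj z * (c *\<^sub>R 1) * z)" if "0 \<le> c" for z c
  proof -
    have "qRe (qcnj z * (c *\<^sub>R 1) * z) = c * (qRe z * qRe z + qIm1 z * qIm1 z + qIm2 z * qIm2 z + qIm3 z * qIm3 z)"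
      by (simp add: algebra_simps)
    then show ?thesis using that by simp
  qed
  show "0 \<le> riesz y (falg_star p * p)"
    unfolding r falg_eval_mult falg_eval_star using sq[of 1] by (intro integral_nonneg_AE) simp
  show "0 \<le> riesz y (falg_star p * g i * p)" if i: "i \<in> {1..m}"
    unfolding r
  proof (rule integral_nonneg_AE)
    from K show "AE a in \<mu>. 0 \<le> qRe (falg_eval (falg_star p * g i * p) a)"
    proof eventually_elim
      case (elim a)
      with i have "falg_eval (g i) a \<in> \<real>\<^sub>\<ge>\<^sub>0" by (auto simp: semialg_set_def)
      then obtain c where "falg_eval (g i) a = c *\<^sub>R 1" "0 \<le> c"
        unfolding nonneg_Reals_quat_iff by blast
      then show ?case unfolding falg_eval_mult falg_eval_star using sq by simp
    qed
  qed
  show "riesz y (p * h j * q) = 0" if j: "j \<in> {1..l}"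
    unfolding r
  proof (rule integral_eq_zero_AE)
    from K show "AE a in \<mu>. qRe (falg_eval (p * h j * q) a) = 0"
      by eventually_elim (use j in \<open>auto simp: semialg_set_def falg_eval_mult\<close>)
  qed
  have "falg_eval (commutator (mon w + mon (word_star w)) x) a = 0" for a
    by (simp add: commutator_def falg_eval_diff falg_eval_mult falg_eval_add word_eval_star quat_eq_iff)
  then show "riesz y (p * commutator (mon w + mon (word_star w)) x * q) = 0"
    unfolding r falg_eval_mult by simp
qed

section \<open>Sufficiency: the functional of a pseudo-moment sequence\<close>

lemma falg_induct_scale [case_names zero add]:
  assumes "P 0" "\<And>p r w. P p \<Longrightarrow> P (p + falg_scale r (mon w))"
  shows "P (p :: 'n falg)"
proof (induction p rule: poly_mapping_add_single_induct)
  case (add p w r)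
  have "Poly_Mapping.single w r = falg_scale r (mon w)" by (simp add: falg_scale_def mult_single)
  with assms(2)[OF add, of r w] show ?case by simp
qed (rule assms(1))

lemma falg_scale_distrib:
  "falg_scale r (p + q) = falg_scale r p + falg_scale r q"
  by (simp add: falg_scale_def distrib_left)

lemma riesz_diff: "riesz y (p - q) = riesz y p - riesz y q"
  by (metis add_diff_cancel_right' diff_add_cancel riesz_add)

lemma riesz_star:
  assumes "pseudo_moment_seq y"
  shows "riesz y (falg_star p) = riesz y p"
  by (induction p rule: poly_mapping_add_single_induct)
    (use assms in \<open>simp_all add: riesz_add pseudo_moment_seq_def\<close>)

lemma riesz_trace:
  assumes "pseudo_moment_seq y"
  shows "riesz y (p * q) = riesz y (q * p)"
proof (induction p rule: falg_induct_scale)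
  case (add p r w)
  have "riesz y (mon w * q) = riesz y (q * mon w)"
  proof (induction q rule: poly_mapping_add_single_induct)
    case (add q v s)
    have "y (w + v) = y (v + w)"
      using assms unfolding pseudo_moment_seq_def cyc_equiv_def by blast
    with add show ?case by (simp add: distrib_left distrib_right riesz_add mult_single)
  qed simp
  with add show ?case by (simp add: distrib_left distrib_right riesz_add riesz_falg_scale)
qed simp

text \<open>The hypothesis concerns the letters q_i only. The involution yields the conjugate
  letters, the trace extends this to words, and linearity to all \<open>x\<close>. A symmetric
  \<open>c\<close> is half of c + c*, which is a combination of the elements w + w*.\<close>

lemma riesz_central:
  assumes y: "pseudo_moment_seq y" and c: "c \<in> Sym"
    and comm: "\<And>u v w i. riesz y (mon u * commutator (mon w + mon (word_star w)) (mon (letter_word (Q i))) * mon v) = 0"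
  shows "riesz y (p * (c * x)) = riesz y (p * (x * c))"
proof -
  note tr = riesz_trace[OF y] and st = riesz_star[OF y]
  note lin = distrib_left distrib_right riesz_add riesz_falg_scale mult.assoc
  define s where "s w = mon w + mon (word_star w)" for w :: "'a qword"
  have s_star: "falg_star (s w) = s w" for w by (simp add: s_def add.commute)
  have Q: "riesz y (p * (s w * mon (letter_word (Q i)))) = riesz y (p * (mon (letter_word (Q i)) * s w))" for p w i
  proof (induction p rule: falg_induct_scale)
    case (add p r u)
    have "riesz y (mon u * (s w * mon (letter_word (Q i)) - mon (letter_word (Q i)) * s w)) = 0"
      using comm[of u w i 0] by (simp add: s_def commutator_def)
    with add show ?case by (simp add: lin right_diff_distrib riesz_diff)
  qed simp
  have letter: "riesz y (p * (s w * mon (letter_word z))) = riesz y (p * (mon (letter_word z) * s w))" for p w z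
  proof (cases z)
    case (Qbar i)
    let ?q = "mon (letter_word (Q i))"
    have "riesz y (p * (s w * mon (letter_word z))) = riesz y (falg_star p * (?q * s w))"
      using st[of "p * (s w * mon (letter_word z))"] tr[of "?q * s w" "falg_star p"]
      by (simp add: Qbar s_star)
    also have "\<dots> = riesz y (falg_star p * (s w * ?q))" by (rule Q[symmetric])
    also have "\<dots> = riesz y (p * (mon (letter_word z) * s w))"
      using st[of "falg_star p * (s w * ?q)"] tr[of "mon (letter_word z) * s w" p]
      by (simp add: Qbar s_star)
    finally show ?thesis .
  qed (use Q in simp)
  have word: "riesz y (p * (s w * mon v)) = riesz y (p * (mon v * s w))" for p w v
  proof (induct v arbitrary: p)
    case (add z v)
    have zv: "mon (letter_word z + v) = mon (letter_word z) * mon v" by (simp add: mult_single)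
    have "riesz y (p * (s w * mon (letter_word z + v))) = riesz y (mon v * p * (s w * mon (letter_word z)))"
      using tr[of "mon v" "p * (s w * mon (letter_word z))"] by (simp add: zv mult.assoc)
    also have "\<dots> = riesz y (p * mon (letter_word z) * (s w * mon v))"
      using letter[of "mon v * p" w z] tr[of "mon v" "p * mon (letter_word z) * s w"] by (simp add: mult.assoc)
    also have "\<dots> = riesz y (p * (mon (letter_word z + v) * s w))"
      unfolding add by (simp add: zv mult.assoc)
    finally show ?case .
  qed simp
  have poly: "riesz y (p * (s w * x)) = riesz y (p * (x * s w))" for w
    by (induction x rule: falg_induct_scale) (simp_all add: lin word)
  have "riesz y (p * ((d + falg_star d) * x)) = riesz y (p * (x * (d + falg_star d)))" for d
  proof (induction d rule: falg_induct_scale)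
    case (add d r w)
    have "d + falg_scale r (mon w) + falg_star (d + falg_scale r (mon w)) = (d + falg_star d) + falg_scale r (s w)"
      by (simp add: s_def falg_scale_distrib)
    with add poly[of w] show ?case by (simp only: lin falg_scale_simps)
  qed simp
  from this[of c] c show ?thesis by (simp add: Sym_iff lin)
qed

lemma central_trace_riesz:
  assumes y: "pseudo_moment_seq y" and g: "\<forall>i\<in>{1..m}. g i \<in> Sym"
    and pos: "\<And>p. 0 \<le> riesz y (falg_star p * p)"
    and posg: "\<And>p i. i \<in> {1..m} \<Longrightarrow> 0 \<le> riesz y (falg_star p * g i * p)"
    and h: "\<And>u v j. j \<in> {1..l} \<Longrightarrow> riesz y (mon u * h j * mon v) = 0"
    and comm: "\<And>u v w i. riesz y (mon u * commutator (mon w + mon (word_star w)) (mon (letter_word (Q i))) * mon v) = 0"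
  shows "central_trace (g ` {1..m}) (h ` {1..l}) (riesz y)"
proof
  show "g ` {1..m} \<subseteq> Sym" using g by auto
  show "riesz y (p * c) = 0" if "c \<in> h ` {1..l}" for p c
  proof (induction p rule: falg_induct_scale)
    case (add p r w)
    obtain j where "j \<in> {1..l}" "c = h j" using \<open>c \<in> h ` {1..l}\<close> by blast
    with h[of j w 0] have "riesz y (mon w * c) = 0" by simp
    with add show ?case by (simp add: distrib_right riesz_add riesz_falg_scale)
  qed simp
  show "0 \<le> riesz y (falg_star p * (f * p))" if "f \<in> insert 1 (g ` {1..m})" for f p
    using that pos posg by (auto simp: mult.assoc)
qed (use y comm in \<open>auto simp: riesz_add riesz_falg_scale intro: riesz_star riesz_trace riesz_central\<close>)

text \<open>A version of \<open>semialg_set\<close> for sets of constraints, to which the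
  Archimedean element can be adjoined.\<close>

definition positivity_set :: "'n::finite falg set \<Rightarrow> 'n falg set \<Rightarrow> (quat ^ 'n) set" where
  "positivity_set G H = {a. (\<forall>g\<in>G. falg_eval g a \<in> \<real>\<^sub>\<ge>\<^sub>0) \<and> (\<forall>h\<in>H. falg_eval h a = 0)}"

text \<open>The real part of the gap at \<open>a\<close> is \<open>R\<close> minus the squared norm
  of \<open>a\<close>, so its positivity bounds the set.\<close>

lemma compact_positivity_set:
  assumes "norm_gap R \<in> G"
  shows "compact (positivity_set G H)"
proof -
  have "closed {a. falg_eval g a \<in> \<real>\<^sub>\<ge>\<^sub>0}" for g :: "'a falg"
    unfolding nonneg_Reals_quat_iff
    by (intro closed_Collect_conj closed_Collect_eq closed_Collect_le continuous_intros continuous_on_falg_eval)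
  moreover have "closed {a. falg_eval h a = 0}" for h :: "'a falg"
    by (intro closed_Collect_eq continuous_intros continuous_on_falg_eval)
  moreover have "positivity_set G H = (\<Inter>g\<in>G. {a. falg_eval g a \<in> \<real>\<^sub>\<ge>\<^sub>0}) \<inter> (\<Inter>h\<in>H. {a. falg_eval h a = 0})"
    by (auto simp: positivity_set_def)
  ultimately have "closed (positivity_set G H)" by (simp only:) (intro closed_Int closed_INT ballI; simp)
  moreover have "norm a \<le> sqrt R" if "a \<in> positivity_set G H" for a
  proof -
    have sum: "falg_eval (\<Sum>i\<in>A. f i) a = (\<Sum>i\<in>A. falg_eval (f i) a)" for A :: "'a set" and f
      by (induction A rule: infinite_finite_induct) (simp_all add: falg_eval_add)
    have "qRe (\<Sum>i\<in>A. f i) = (\<Sum>i\<in>A. qRe (f i))" for A :: "'a set" and f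
      by (induction A rule: infinite_finite_induct) simp_all
    moreover have "qRe (a $ i * qcnj (a $ i)) = (norm (a $ i))\<^sup>2" for i
      unfolding power2_norm_eq_inner by (simp add: inner_quat_def)
    ultimately have "qRe (falg_eval (norm_gap R) a) = R - (\<Sum>i\<in>UNIV. (norm (a $ i))\<^sup>2)"
      by (simp add: norm_gap_def falg_eval_diff sum word_eval_add)
    moreover have "0 \<le> qRe (falg_eval (norm_gap R) a)"
      using that assms by (auto simp: positivity_set_def nonneg_Reals_quat_iff)
    ultimately show ?thesis by (simp add: norm_vec_def L2_set_def)
  qed
  ultimately show ?thesis by (auto simp: compact_eq_bounded_closed bounded_iff)
qed

lemma states_representing_measure:
  fixes z :: "'n::finite qword \<Rightarrow> real"
  assumes z: "z \<in> states R G H"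
  obtains \<mu> where "represents \<mu> z" "AE a in \<mu>. a \<in> positivity_set G H"
proof -
  obtain w :: "nat \<Rightarrow> 'n qword" where w: "range w = UNIV"
    using countable_qword by (metis UNIV_not_empty uncountable_def)
  interpret tracial_positive R G H "riesz z" using z by (simp add: states_def)
  let ?K = "positivity_set G H" and ?F = "\<lambda>i a. qRe (word_eval a (w i))"
  have supp: "\<exists>a\<in>?K. (\<Sum>i<N. d i * ?F i a) \<le> (\<Sum>i<N. d i * z (w i))" for N :: nat and d
  proof -
    \<comment> \<open>A linear combination of moments is the value of the functional at this
      polynomial, so the evaluation bound for states is the support condition on the
      moments.\<close>
    define p where "p = (\<Sum>i<N. Poly_Mapping.single (w i) (d i))"
    obtain a where a: "\<And>g. g \<in> G \<Longrightarrow> falg_eval g a \<in> \<real>\<^sub>\<ge>\<^sub>0" "\<And>h. h \<in> H \<Longrightarrow> falg_eval h a = 0"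
      and le: "qRe (falg_eval p a) \<le> riesz z p"
      using states_evaluation_lower_bound[OF z, of p] by blast
    have "qRe (falg_eval p a) = (\<Sum>i<N. d i * ?F i a)"
      unfolding p_def by (induction N) (simp_all add: falg_eval_add)
    moreover have "riesz z p = (\<Sum>i<N. d i * z (w i))"
      unfolding p_def by (simp add: sum)
    ultimately have "(\<Sum>i<N. d i * ?F i a) \<le> (\<Sum>i<N. d i * z (w i))" using le by simp
    moreover have "a \<in> ?K" using a by (simp add: positivity_set_def)
    ultimately show ?thesis by blast
  qed
  obtain \<mu> where \<mu>: "sets \<mu> = sets borel" "AE a in \<mu>. a \<in> ?K"
    "\<And>i. integrable \<mu> (?F i)" "\<And>i. integral\<^sup>L \<mu> (?F i) = z (w i)"
    by (rule moment_measure_exists[OF compact_positivity_set[OF gap_in_G, of H],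
          where F = ?F and y = "\<lambda>i. z (w i)"])
      (intro continuous_intros continuous_on_word_eval, rule supp, blast)
  have "\<exists>i. u = w i" for u using w by (metis rangeE UNIV_I)
  then have "represents \<mu> z"
    unfolding represents_def using \<mu> by metis
  with \<mu>(2) show ?thesis by (rule that[rotated])
qed

lemma tracial_positive_representing_measure:
  fixes y :: "'n::finite qword \<Rightarrow> real"
  assumes "tracial_positive R G H (riesz y)"
  obtains \<mu> where "represents \<mu> y" "AE a in \<mu>. a \<in> positivity_set G H"
proof -
  interpret tracial_positive R G H "riesz y" by fact
  have y0: "y 0 = riesz y 1" by (simp flip: single_one)
  then have nn: "0 \<le> y 0" using square_nonneg[of 1] by simp
  show ?thesis
  proof (cases "y 0 = 0")
    case True
    then have "y w = 0" for w using eq_zero_if_mass_zero[of "mon w"] y0 by simp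
    \<comment> \<open>The zero measure, written as a density so that it carries the Borel
      sets.\<close>
    moreover define \<mu> where "\<mu> = density (lborel :: (quat ^ 'n) measure) (\<lambda>_. 0)"
    have AE: "AE a in \<mu>. P a" for P unfolding \<mu>_def by (subst AE_density) simp_all
    have "integrable \<mu> (\<lambda>a. qRe (word_eval a w))" for w
      by (rule integrable_cong_AE_imp[OF integrable_zero _ AE])
        (simp add: \<mu>_def borel_measurable_continuous_onI continuous_on_qRe continuous_on_word_eval)
    moreover have "(\<integral>a. qRe (word_eval a w) \<partial>\<mu>) = 0" for w
      by (rule integral_eq_zero_AE[OF AE])
    ultimately have "represents \<mu> y" by (simp add: represents_def \<mu>_def)
    then show ?thesis using AE by (rule that)
  next
    case False
    define z where "z w = 1 / y 0 * y w" for w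
    have rz: "1 / y 0 * riesz y p = riesz z p" for p
      by (simp add: riesz_def z_def sum_divide_distrib)
    have "tracial_positive R G H (\<lambda>p. 1 / y 0 * riesz y p)" using nn by (intro positive_multiple) simp
    then have "tracial_positive R G H (riesz z)" unfolding rz .
    then have "z \<in> states R G H" using False by (simp add: states_def) (simp add: z_def)
    then obtain \<mu> where \<mu>: "represents \<mu> z" "AE a in \<mu>. a \<in> positivity_set G H"
      by (rule states_representing_measure)
    have sets: "sets \<mu> = sets borel" using \<mu>(1) by (simp add: represents_def)
    then have m: "(\<lambda>a. qRe (word_eval a w)) \<in> borel_measurable \<mu>" for w
      by (simp add: measurable_cong_sets[OF sets refl] borel_measurable_continuous_onI
          continuous_on_qRe continuous_on_word_eval)
    have "z w = (\<integral>a. qRe (word_eval a w) \<partial>\<mu>)" for w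
      using \<mu>(1) unfolding represents_def by blast
    from this[symmetric] have "y 0 * (\<integral>a. qRe (word_eval a w) \<partial>\<mu>) = y w" for w
      using False by (simp add: z_def)
    then have "represents (density \<mu> (\<lambda>_. y 0)) y"
      using \<mu>(1) nn m sets by (simp add: represents_def integrable_density integral_density)
    moreover have "AE a in density \<mu> (\<lambda>_. ennreal (y 0)). a \<in> positivity_set G H"
      using \<mu>(2) by (simp add: AE_density)
    ultimately show ?thesis by (rule that)
  qed
qed

theorem corollary5p4:
  fixes g h :: "nat \<Rightarrow> 'n::finite falg" and m l :: nat and y :: "'n qword \<Rightarrow> real"
  assumes "\<forall>i\<in>{1..m}. g i \<in> Sym"
    and "archimedean_module (quad_module m g l h)"
    and "pseudo_moment_seq y"
  shows "(\<exists>\<mu>. represents \<mu> y \<and> (AE a in \<mu>. a \<in> semialg_set m g l h)) \<longleftrightarrow>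
    (\<forall>p. riesz y (falg_star p * p) \<ge> 0) \<and>
    (\<forall>p. \<forall>i\<in>{1..m}. riesz y (falg_star p * g i * p) \<ge> 0) \<and>
    (\<forall>u v. \<forall>j\<in>{1..l}. riesz y (mon u * h j * mon v) = 0) \<and>
    (\<forall>u v w i. riesz y (mon u * commutator (mon w + mon (word_star w)) (mon (letter_word (Q i))) * mon v) = 0)"
    (is "?L \<longleftrightarrow> ?R")
proof
  assume ?L
  then obtain \<mu> where "represents \<mu> y" "AE a in \<mu>. a \<in> semialg_set m g l h" by blast
  note conditions = representing_measure_conditions[OF this]
  show ?R by (intro conjI allI ballI conditions)
next
  assume ?R
  then interpret central_trace "g ` {1..m}" "h ` {1..l}" "riesz y"
    by (intro central_trace_riesz assms) blast+
  obtain R where R: "0 < R" "norm_gap R \<in> quad_module m g l h"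
    using assms(2) unfolding archimedean_module_def norm_gap_def by blast
  \<comment> \<open>An additional constraint can only shrink the set of admissible points, so a
    measure supported on the smaller set is also supported on the semialgebraic set.\<close>
  let ?G = "insert (norm_gap R) (g ` {1..m})" and ?H = "h ` {1..l}"
  have "falg_star (norm_gap R) = norm_gap R"
    by (simp add: norm_gap_def falg_star_sum word_star_add)
  moreover have gap: "0 \<le> riesz y (falg_star p * (norm_gap R * p))" for p
    by (rule quad_module_nonneg[OF _ _ R(2)]) auto
  ultimately have "tracial_positive R ?G ?H (riesz y)"
    using R(1) G_Sym
  proof unfold_locales
    show "0 \<le> riesz y (falg_star p * (f * p))" if "f \<in> insert 1 ?G" for f p
      using that nonneg[of f p] gap by blast
  qed (use add scale star trace ideal central in \<open>auto simp: Sym_iff\<close>)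
  then obtain \<mu> where "represents \<mu> y" "AE a in \<mu>. a \<in> positivity_set ?G ?H"
    by (rule tracial_positive_representing_measure)
  moreover from this(2) have "AE a in \<mu>. a \<in> semialg_set m g l h"
    by eventually_elim (auto simp: positivity_set_def semialg_set_def)
  ultimately show ?L by blast
qed

end
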